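(* For every selection probability $r\in(0,1)$, the $L^2$ convergence rates of the random-scan Gibbs kernel $P_{\mathrm{RG}}$ (with selection probability $r$) and of the deterministic-scan Gibbs kernel $P_{\mathrm{DG}}$ satisfy \[ \rho(P_{\mathrm{RG}}) = \frac{1+\sqrt{1-4r(1-r)\,[1-\rho(P_{\mathrm{DG}})]}}{2}. \]
   Context: Setting. $(\mathsf{X}\times\mathsf{Y},\mathcal{F}_X\times\mathcal{F}_Y)$ is a product measurable space with a joint probability distribution $\Pi(dx,dy)$; $\Pi_X,\Pi_Y$ are its marginals and $\Pi_{X|Y}(dx|y)$, $\Pi_{Y|X}(dy|x)$ its full conditional distributions (regular conditional probabilities). Standing assumption: there exist disjoint $A_1,A_2\in\mathcal{F}_X$ with $\Pi_X(A_1),\Pi_X(A_2)>0$ and disjoint $B_1,B_2\in\mathcal{F}_Y$ with $\Pi_Y(B_1),\Pi_Y(B_2)>0$. Kernels on $\mathsf{X}\times\mathsf{Y}$ ($\delta_x,\delta_y$ are point masses), both having $\Pi$ as invariant distribution: \[P_{\mathrm{DG}}((x,y),(dx',dy'))=\Pi_{X|Y}(dx'|y')\,\Pi_{Y|X}(dy'|x),\] \[P_{\mathrm{RG}}((x,y),(dx',dy'))=r\,\Pi_{X|Y}(dx'|y)\,\delta_y(dy')+(1-r)\,\Pi_{Y|X}(dy'|x)\,\delta_x(dx').\] $L^2$ convergence rate. Let $P$ be a Markov transition kernel with invariant probability measure $\omega$. $L^2(\omega)$ is the real Hilbert space of square-integrable real functions, and $L_0^2(\omega)=\{f\in L^2(\omega):\int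 f\,d\omega=0\}$. For probability measures $\mu,\nu$, $\|\mu-\nu\|_\omega=\sup\{|\int f\,d\mu-\int f\,d\nu|: f\in L_0^2(\omega),\|f\|_\omega=1\}$. $L_*^2(\omega)$ is the set of probability measures $\mu$ with $d\mu/d\omega\in L^2(\omega)$. $(\mu P^n)(A)=\int \mu(dz)P^n(z,A)$, where $P^n$ is the $n$-step kernel. The $L^2$ convergence rate $\rho(P)$ is the infimum of $\rho\in[0,1]$ such that for each $\mu\in L_*^2(\omega)$ there is $C_\mu<\infty$ with $\|\mu P^n-\omega\|_\omega<C_\mu\rho^n$ for every positive integer $n$. *)

theory Defs
  imports "HOL-Probability.Probability"
begin

text \<open>A Markov kernel from \<open>N\<close> to \<open>M\<close> is a measurable map \<^term>\<open>\<kappa> \<in> N \<rightarrow>\<^sub>M prob_algebra M\<close>.\<close>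

text \<open>\<open>\<kappa>\<close> is a regular conditional distribution of the random element \<open>S\<close> of \<open>M\<close> given the
  random element \<open>T\<close> of \<open>N\<close>, both defined on the probability space \<open>\<Omega>\<close>.\<close>

definition regular_conditional ::
  "'w measure \<Rightarrow> 'a measure \<Rightarrow> ('w \<Rightarrow> 'a) \<Rightarrow> 'b measure \<Rightarrow> ('w \<Rightarrow> 'b) \<Rightarrow> ('b \<Rightarrow> 'a measure) \<Rightarrow> bool"
where
  "regular_conditional \<Omega> M S N T \<kappa> \<longleftrightarrow>
     \<kappa> \<in> N \<rightarrow>\<^sub>M prob_algebra M \<and>
     (\<forall>A\<in>sets M. \<forall>B\<in>sets N.
        emeasure \<Omega> {w \<in> space \<Omega>. S w \<in> A \<and> T w \<in> B}
          = (\<integral>\<^sup>+ t \<in> B. emeasure (\<kappa> t) A \<partial>(distr \<Omega> N T)))"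


text \<open>In the two Gibbs kernels below, \<open>KX\<close> stands for the conditional distribution of the first
  coordinate given the second, and \<open>KY\<close> for that of the second given the first.\<close>

definition det_scan_gibbs ::
  "'x measure \<Rightarrow> 'y measure \<Rightarrow> ('y \<Rightarrow> 'x measure) \<Rightarrow> ('x \<Rightarrow> 'y measure) \<Rightarrow> 'x \<times> 'y \<Rightarrow> ('x \<times> 'y) measure"
where
  "det_scan_gibbs MX MY KX KY z =
     KY (fst z) \<bind> (\<lambda>y'. distr (KX y') (MX \<Otimes>\<^sub>M MY) (\<lambda>x'. (x', y')))"

definition rand_scan_gibbs ::
  "real \<Rightarrow> 'x measure \<Rightarrow> 'y measure \<Rightarrow> ('y \<Rightarrow> 'x measure) \<Rightarrow> ('x \<Rightarrow> 'y measure)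
    \<Rightarrow> 'x \<times> 'y \<Rightarrow> ('x \<times> 'y) measure"
where
  "rand_scan_gibbs r MX MY KX KY z =
     measure_of (space (MX \<Otimes>\<^sub>M MY)) (sets (MX \<Otimes>\<^sub>M MY))
       (\<lambda>A. ennreal r * emeasure (distr (KX (snd z)) (MX \<Otimes>\<^sub>M MY) (\<lambda>x'. (x', snd z))) A
          + ennreal (1 - r) * emeasure (distr (KY (fst z)) (MX \<Otimes>\<^sub>M MY) (\<lambda>y'. (fst z, y'))) A)"


text \<open>Elements of \<open>L\<^sup>2(\<omega>)\<close> are represented by functions rather than by classes modulo
  \<open>\<omega>\<close>-null sets; only integrals against measures absolutely continuous with respect to \<open>\<omega>\<close>
  matter in the convergence rate, and these do not depend on the representative.\<close>

definition L2_fun :: "'a measure \<Rightarrow> ('a \<Rightarrow> real) set" where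
  "L2_fun \<omega> = {f \<in> borel_measurable \<omega>. integrable \<omega> (\<lambda>z. (f z)\<^sup>2)}"

definition L2_fun0 :: "'a measure \<Rightarrow> ('a \<Rightarrow> real) set" where
  "L2_fun0 \<omega> = {f \<in> L2_fun \<omega>. (\<integral>z. f z \<partial>\<omega>) = 0}"

definition L2_fun_norm :: "'a measure \<Rightarrow> ('a \<Rightarrow> real) \<Rightarrow> real" where
  "L2_fun_norm \<omega> f = sqrt (\<integral>z. (f z)\<^sup>2 \<partial>\<omega>)"

text \<open>The supremum is taken in \<^typ>\<open>ennreal\<close>, so that no boundedness has to be presupposed.\<close>

definition L2_dist :: "'a measure \<Rightarrow> 'a measure \<Rightarrow> 'a measure \<Rightarrow> ennreal" where
  "L2_dist \<omega> \<mu> \<nu> =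
     (SUP f \<in> {f \<in> L2_fun0 \<omega>. L2_fun_norm \<omega> f = 1}. ennreal \<bar>(\<integral>z. f z \<partial>\<mu>) - (\<integral>z. f z \<partial>\<nu>)\<bar>)"

text \<open>Passing from \<^typ>\<open>ennreal\<close> to \<^typ>\<open>real\<close> is harmless here, since the derivative of a finite
  measure is finite almost everywhere.\<close>

definition L2_prob :: "'a measure \<Rightarrow> 'a measure set" where
  "L2_prob \<omega> = {\<mu>. prob_space \<mu> \<and> sets \<mu> = sets \<omega> \<and> absolutely_continuous \<omega> \<mu> \<and>
                   (\<lambda>z. enn2real (RN_deriv \<omega> \<mu> z)) \<in> L2_fun \<omega>}"

primrec kernel_power :: "'a measure \<Rightarrow> ('a \<Rightarrow> 'a measure) \<Rightarrow> nat \<Rightarrow> 'a \<Rightarrow> 'a measure" where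
  "kernel_power M P 0 = return M"
| "kernel_power M P (Suc n) = (\<lambda>z. kernel_power M P n z \<bind> P)"

definition L2_rate :: "'a measure \<Rightarrow> ('a \<Rightarrow> 'a measure) \<Rightarrow> real" where
  "L2_rate \<omega> P = Inf {\<rho> \<in> {0..1}. \<forall>\<mu>\<in>L2_prob \<omega>. \<exists>C. \<forall>n::nat. 1 \<le> n \<longrightarrow>
       L2_dist \<omega> (\<mu> \<bind> kernel_power \<omega> P n) \<omega> < ennreal (C * \<rho> ^ n)}"


text \<open>The Gibbs kernels are Markov kernels and integrate as expected.\<close>

lemma measurable_det_scan_gibbs:
  assumes [measurable]: "KX \<in> MY \<rightarrow>\<^sub>M prob_algebra MX" "KY \<in> MX \<rightarrow>\<^sub>M prob_algebra MY"
  shows "det_scan_gibbs MX MY KX KY \<in> MX \<Otimes>\<^sub>M MY \<rightarrow>\<^sub>M prob_algebra (MX \<Otimes>\<^sub>M MY)"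
  unfolding det_scan_gibbs_def[abs_def]
  by (intro measurable_bind_prob_space2[where N = MY] measurable_distr_prob_space2[where M = MX])
     measurable

lemma emeasure_det_scan_gibbs:
  assumes KX[measurable]: "KX \<in> MY \<rightarrow>\<^sub>M prob_algebra MX"
    and KY[measurable]: "KY \<in> MX \<rightarrow>\<^sub>M prob_algebra MY"
    and z: "z \<in> space (MX \<Otimes>\<^sub>M MY)" and A[measurable]: "A \<in> sets (MX \<Otimes>\<^sub>M MY)"
  shows "emeasure (det_scan_gibbs MX MY KX KY z) A
           = (\<integral>\<^sup>+ y'. \<integral>\<^sup>+ x'. indicator A (x', y') \<partial>KX y' \<partial>KY (fst z))"
proof -
  have x: "fst z \<in> space MX" using z by (auto simp: space_pair_measure)
  have KYz: "KY (fst z) \<in> space (prob_algebra MY)" using measurable_space[OF KY x] .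
  then have sKY: "space (KY (fst z)) = space MY"
    by (auto simp: space_prob_algebra dest: sets_eq_imp_space_eq)
  have ker: "(\<lambda>y'. distr (KX y') (MX \<Otimes>\<^sub>M MY) (\<lambda>x'. (x', y'))) \<in> MY \<rightarrow>\<^sub>M prob_algebra (MX \<Otimes>\<^sub>M MY)"
    by (intro measurable_distr_prob_space2[where M = MX]) measurable
  have "emeasure (det_scan_gibbs MX MY KX KY z) A
      = (\<integral>\<^sup>+ y'. emeasure (distr (KX y') (MX \<Otimes>\<^sub>M MY) (\<lambda>x'. (x', y'))) A \<partial>KY (fst z))"
    unfolding det_scan_gibbs_def by (rule emeasure_bind_prob_algebra[OF KYz ker A])
  also have "\<dots> = (\<integral>\<^sup>+ y'. \<integral>\<^sup>+ x'. indicator A (x', y') \<partial>KX y' \<partial>KY (fst z))"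
  proof (rule nn_integral_cong)
    fix y assume "y \<in> space (KY (fst z))"
    then have y: "y \<in> space MY" by (simp add: sKY)
    then have s[measurable_cong]: "sets (KX y) = sets MX"
      using measurable_space[OF KX y] by (simp add: space_prob_algebra)
    have m: "(\<lambda>x'. (x', y)) \<in> KX y \<rightarrow>\<^sub>M MX \<Otimes>\<^sub>M MY" using y by measurable
    have "emeasure (distr (KX y) (MX \<Otimes>\<^sub>M MY) (\<lambda>x'. (x', y))) A
        = (\<integral>\<^sup>+ z. indicator A z \<partial>distr (KX y) (MX \<Otimes>\<^sub>M MY) (\<lambda>x'. (x', y)))"
      by simp
    also have "\<dots> = (\<integral>\<^sup>+ x'. indicator A (x', y) \<partial>KX y)"
      by (rule nn_integral_distr[OF m]) simp
    finally show "emeasure (distr (KX y) (MX \<Otimes>\<^sub>M MY) (\<lambda>x'. (x', y))) A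
        = (\<integral>\<^sup>+ x'. indicator A (x', y) \<partial>KX y)" .
  qed
  finally show ?thesis .
qed

lemma emeasure_rand_scan_gibbs:
  assumes KX[measurable]: "KX \<in> MY \<rightarrow>\<^sub>M prob_algebra MX"
    and KY[measurable]: "KY \<in> MX \<rightarrow>\<^sub>M prob_algebra MY"
    and z: "z \<in> space (MX \<Otimes>\<^sub>M MY)" and A[measurable]: "A \<in> sets (MX \<Otimes>\<^sub>M MY)"
  shows "emeasure (rand_scan_gibbs r MX MY KX KY z) A
           = ennreal r * (\<integral>\<^sup>+ x'. indicator A (x', snd z) \<partial>KX (snd z))
             + ennreal (1 - r) * (\<integral>\<^sup>+ y'. indicator A (fst z, y') \<partial>KY (fst z))"
proof -
  define \<mu>1 where "\<mu>1 = distr (KX (snd z)) (MX \<Otimes>\<^sub>M MY) (\<lambda>x'. (x', snd z))"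
  define \<mu>2 where "\<mu>2 = distr (KY (fst z)) (MX \<Otimes>\<^sub>M MY) (\<lambda>y'. (fst z, y'))"
  have x: "fst z \<in> space MX" and y: "snd z \<in> space MY"
    using z by (auto simp: space_pair_measure)
  have s[measurable_cong]: "sets (KX (snd z)) = sets MX" "sets (KY (fst z)) = sets MY"
    using measurable_space[OF KX y] measurable_space[OF KY x] by (auto simp: space_prob_algebra)
  have "countably_additive (sets (MX \<Otimes>\<^sub>M MY))
          (\<lambda>A. ennreal r * emeasure \<mu>1 A + ennreal (1 - r) * emeasure \<mu>2 A)"
  proof (rule countably_additiveI)
    fix F :: "nat \<Rightarrow> _"
    assume F: "range F \<subseteq> sets (MX \<Otimes>\<^sub>M MY)" "disjoint_family F"
    show "(\<Sum>i. ennreal r * emeasure \<mu>1 (F i) + ennreal (1 - r) * emeasure \<mu>2 (F i))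
        = ennreal r * emeasure \<mu>1 (\<Union>i. F i) + ennreal (1 - r) * emeasure \<mu>2 (\<Union>i. F i)"
      using F suminf_emeasure[of F \<mu>1] suminf_emeasure[of F \<mu>2]
      by (simp add: suminf_add[symmetric] \<mu>1_def \<mu>2_def)
  qed
  then have "emeasure (rand_scan_gibbs r MX MY KX KY z) A
      = ennreal r * emeasure \<mu>1 A + ennreal (1 - r) * emeasure \<mu>2 A"
    unfolding rand_scan_gibbs_def \<mu>1_def[symmetric] \<mu>2_def[symmetric]
    by (intro emeasure_measure_of_sigma)
       (auto simp: positive_def intro: sets.sigma_algebra_axioms)
  moreover have "emeasure \<mu>1 A = (\<integral>\<^sup>+ x'. indicator A (x', snd z) \<partial>KX (snd z))"
  proof -
    have m: "(\<lambda>x'. (x', snd z)) \<in> KX (snd z) \<rightarrow>\<^sub>M MX \<Otimes>\<^sub>M MY" using y by measurable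
    have "emeasure \<mu>1 A = (\<integral>\<^sup>+ w. indicator A w \<partial>\<mu>1)" by (simp add: \<mu>1_def)
    also have "\<dots> = (\<integral>\<^sup>+ x'. indicator A (x', snd z) \<partial>KX (snd z))"
      unfolding \<mu>1_def by (rule nn_integral_distr[OF m]) simp
    finally show ?thesis .
  qed
  moreover have "emeasure \<mu>2 A = (\<integral>\<^sup>+ y'. indicator A (fst z, y') \<partial>KY (fst z))"
  proof -
    have m: "(\<lambda>y'. (fst z, y')) \<in> KY (fst z) \<rightarrow>\<^sub>M MX \<Otimes>\<^sub>M MY" using x by measurable
    have "emeasure \<mu>2 A = (\<integral>\<^sup>+ w. indicator A w \<partial>\<mu>2)" by (simp add: \<mu>2_def)
    also have "\<dots> = (\<integral>\<^sup>+ y'. indicator A (fst z, y') \<partial>KY (fst z))"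
      unfolding \<mu>2_def by (rule nn_integral_distr[OF m]) simp
    finally show ?thesis .
  qed
  ultimately show ?thesis by simp
qed

lemma measurable_rand_scan_gibbs:
  assumes KX[measurable]: "KX \<in> MY \<rightarrow>\<^sub>M prob_algebra MX"
    and KY[measurable]: "KY \<in> MX \<rightarrow>\<^sub>M prob_algebra MY"
    and r: "0 \<le> r" "r \<le> 1"
  shows "rand_scan_gibbs r MX MY KX KY \<in> MX \<Otimes>\<^sub>M MY \<rightarrow>\<^sub>M prob_algebra (MX \<Otimes>\<^sub>M MY)"
proof -
  have m1: "(\<lambda>z. distr (KX (snd z)) (MX \<Otimes>\<^sub>M MY) (\<lambda>x'. (x', snd z)))
              \<in> MX \<Otimes>\<^sub>M MY \<rightarrow>\<^sub>M prob_algebra (MX \<Otimes>\<^sub>M MY)"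
    by (intro measurable_distr_prob_space2[where M = MX]) measurable
  have m2: "(\<lambda>z. distr (KY (fst z)) (MX \<Otimes>\<^sub>M MY) (\<lambda>y'. (fst z, y')))
              \<in> MX \<Otimes>\<^sub>M MY \<rightarrow>\<^sub>M prob_algebra (MX \<Otimes>\<^sub>M MY)"
    by (intro measurable_distr_prob_space2[where M = MY]) measurable
  note e1 = measurable_emeasure_kernel[OF measurable_prob_algebraD[OF m1]]
  note e2 = measurable_emeasure_kernel[OF measurable_prob_algebraD[OF m2]]
  have eq: "emeasure (rand_scan_gibbs r MX MY KX KY z) A
      = ennreal r * emeasure (distr (KX (snd z)) (MX \<Otimes>\<^sub>M MY) (\<lambda>x'. (x', snd z))) A
        + ennreal (1 - r) * emeasure (distr (KY (fst z)) (MX \<Otimes>\<^sub>M MY) (\<lambda>y'. (fst z, y'))) A"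
    if z: "z \<in> space (MX \<Otimes>\<^sub>M MY)" and A[measurable]: "A \<in> sets (MX \<Otimes>\<^sub>M MY)" for z A
  proof -
    have x: "fst z \<in> space MX" and y: "snd z \<in> space MY"
      using z by (auto simp: space_pair_measure)
    have s[measurable_cong]: "sets (KX (snd z)) = sets MX" "sets (KY (fst z)) = sets MY"
      using measurable_space[OF KX y] measurable_space[OF KY x] by (auto simp: space_prob_algebra)
    have f1: "(\<lambda>x'. (x', snd z)) \<in> KX (snd z) \<rightarrow>\<^sub>M MX \<Otimes>\<^sub>M MY" using y by measurable
    have f2: "(\<lambda>y'. (fst z, y')) \<in> KY (fst z) \<rightarrow>\<^sub>M MX \<Otimes>\<^sub>M MY" using x by measurable
    show ?thesis
      using nn_integral_distr[OF f1, of "indicator A"] nn_integral_distr[OF f2, of "indicator A"]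
      by (simp add: emeasure_rand_scan_gibbs[OF KX KY z A])
  qed
  have sp: "sets (rand_scan_gibbs r MX MY KX KY z) = sets (MX \<Otimes>\<^sub>M MY)" for z
    unfolding rand_scan_gibbs_def by (simp add: sets.sigma_sets_eq sets.space_closed)
  show ?thesis
  proof (rule measurable_prob_algebra_generated)
    show "sets (MX \<Otimes>\<^sub>M MY) = sigma_sets (space (MX \<Otimes>\<^sub>M MY)) (sets (MX \<Otimes>\<^sub>M MY))"
      by (simp add: sets.sigma_sets_eq)
    show "Int_stable (sets (MX \<Otimes>\<^sub>M MY))" by (auto simp: Int_stable_def)
    show "sets (MX \<Otimes>\<^sub>M MY) \<subseteq> Pow (space (MX \<Otimes>\<^sub>M MY))" by (rule sets.space_closed)
    show "sets (rand_scan_gibbs r MX MY KX KY z) = sets (MX \<Otimes>\<^sub>M MY)" for z by (rule sp)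
    show "prob_space (rand_scan_gibbs r MX MY KX KY z)" if z: "z \<in> space (MX \<Otimes>\<^sub>M MY)" for z
    proof
      have "emeasure (rand_scan_gibbs r MX MY KX KY z) (space (MX \<Otimes>\<^sub>M MY))
          = ennreal r + ennreal (1 - r)"
        using in_space_prob_algebra[OF measurable_space[OF m1 z]]
          in_space_prob_algebra[OF measurable_space[OF m2 z]]
        by (subst eq[OF z]) simp_all
      then show "emeasure (rand_scan_gibbs r MX MY KX KY z)
          (space (rand_scan_gibbs r MX MY KX KY z)) = 1"
        using r sets_eq_imp_space_eq[OF sp] by (simp flip: ennreal_plus)
    qed
    show "(\<lambda>z. emeasure (rand_scan_gibbs r MX MY KX KY z) A) \<in> borel_measurable (MX \<Otimes>\<^sub>M MY)"
      if A: "A \<in> sets (MX \<Otimes>\<^sub>M MY)" for A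
      by (subst measurable_cong[OF eq[OF _ A]])
         (use e1[OF A] e2[OF A] in \<open>auto intro!: borel_measurable_add borel_measurable_times\<close>)
  qed
qed

end

theory Submission
  imports Defs
begin

text \<open>
  Resampling \<open>x\<close> from its conditional law given \<open>y\<close> acts on functions as the conditional
  expectation \<open>p = E[\<cdot> | y]\<close>, and resampling \<open>y\<close> acts as \<open>q = E[\<cdot> | x]\<close>. On the mean-zero
  part of \<open>L\<^sup>2\<close> these are orthogonal projections. The deterministic scan acts as \<open>q \<circ> p\<close>, with
  adjoint \<open>p \<circ> q\<close>, and the random scan acts as the symmetric operator \<open>r p + (1 - r) q\<close>. Both
  rates are therefore determined by how two projections lie relative to each other, and a single
  number decides: the least \<open>c\<close> with \<open>\<langle>p f, q g\<rangle>\<^sup>2 \<le> c \<parallel>f\<parallel>\<^sup>2 \<parallel>g\<parallel>\<^sup>2\<close>, which is the squared maximal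
  correlation of the two coordinates (\<open>correlation_bound\<close>).

  From measures to operators. If \<open>\<mu>\<close> has density \<open>h\<close> and \<open>S\<close> is the adjoint of the kernel, then
  the distance of \<open>\<mu> P\<^sup>n\<close> from equilibrium is \<open>\<parallel>S\<^sup>n (h - 1)\<parallel>\<close> (\<open>L2_dist_density\<close>). Every mean-zero
  \<open>g\<close> is a linear combination of two such \<open>h - 1\<close>, so the rates are exactly the
  geometric rates of the orbits \<open>S\<^sup>n g\<close> (\<open>L2_ratesI\<close>, \<open>L2_ratesD\<close>).

  From orbits to norms. For a symmetric operator, \<open>n \<mapsto> \<parallel>S\<^sup>n u\<parallel>\<close> is log-convex by the
  Cauchy-Schwarz inequality, so its successive ratios increase. A bound \<open>\<parallel>S\<^sup>n u\<parallel> \<le> C \<rho>\<^sup>n\<close>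
  with any constant \<open>C\<close>, which may depend on \<open>u\<close>, then forces \<open>\<parallel>S u\<parallel> \<le> \<rho> \<parallel>u\<parallel>\<close>
  (\<open>selfadjoint_bound_of_orbit_bound\<close>). Applied to the random scan, this identifies its rate with
  the norm of \<open>r p + (1 - r) q\<close>. It also applies to \<open>p \<circ> q\<close>, which is symmetric on the range of
  \<open>p\<close>, and there it shows that the deterministic-scan rate is the least \<open>c\<close>.

  The quadratic. The norm \<open>l\<close> of \<open>r p + (1 - r) q\<close> is governed by the matrix with
  diagonal entries \<open>r\<close>, \<open>1 - r\<close> and off-diagonal entries \<open>sqrt (r (1 - r) c)\<close>, whose
  characteristic equation is \<open>(l - r) (l - (1 - r)) = r (1 - r) c\<close>. Its larger root is the asserted
  formula. That the norm is this root also uses \<open>l \<ge> r\<close> and \<open>l \<ge> 1 - r\<close>, and this is where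
  the disjoint sets of positive probability enter: they make \<open>p\<close> and \<open>q\<close> nonzero
  on mean-zero functions.

  Since functions represent elements of \<open>L\<^sup>2\<close> only up to null sets, the Hilbert space argument is
  carried out for a possibly degenerate semi-inner product. As maps on functions the operators need
  be neither linear nor idempotent, so identities between them are stated after pairing with a test
  function.
\<close>

section \<open>Real inequalities\<close>

lemma discriminant_nonpos:
  fixes a b c :: real
  assumes "0 \<le> a" and nn: "\<And>t. 0 \<le> a * t\<^sup>2 + 2 * b * t + c"
  shows "b\<^sup>2 \<le> a * c"
proof (cases "a = 0")
  case True
  have "b = 0"
  proof (rule ccontr)
    assume "b \<noteq> 0"
    then have "2 * b * (- (c + 1) / (2 * b)) + c = -1" by (simp add: field_simps)
    with nn[of "- (c + 1) / (2 * b)"] True show False by simp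
  qed
  with True show ?thesis by simp
next
  case False
  with assms have "0 < a" by simp
  then have "0 \<le> a * (a * (- b / a)\<^sup>2 + 2 * b * (- b / a) + c)"
    using nn[of "- b / a"] by (intro mult_nonneg_nonneg) auto
  also have "\<dots> = a * c - b\<^sup>2"
    using False by (simp add: power2_eq_square field_simps)
  finally show ?thesis by simp
qed

text \<open>The ratios \<open>s (n + 1) / s n\<close> of a log-convex sequence increase, so \<open>s\<close> grows at least like
  the powers of its first ratio. A geometric upper bound, with whatever constant, caps that ratio.\<close>

lemma log_convex_first_ratio:
  fixes s :: "nat \<Rightarrow> real"
  assumes nn: "\<And>n. 0 \<le> s n" and conv: "\<And>n. (s (Suc n))\<^sup>2 \<le> s n * s (Suc (Suc n))"
    and bd: "\<And>n. 1 \<le> n \<Longrightarrow> s n \<le> C * \<rho> ^ n" and "0 \<le> \<rho>"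
  shows "s 1 \<le> \<rho> * s 0"
proof (rule ccontr)
  assume "\<not> ?thesis"
  then have less: "\<rho> * s 0 < s 1" by simp
  have s0: "0 < s 0"
  proof (rule ccontr)
    assume "\<not> 0 < s 0"
    with nn[of 0] have "s 0 = 0" by simp
    with conv[of 0] less show False by simp
  qed
  define \<kappa> where "\<kappa> = s 1 / s 0"
  have \<kappa>: "\<rho> < \<kappa>" using less s0 by (simp add: \<kappa>_def field_simps)
  with \<open>0 \<le> \<rho>\<close> have \<kappa>0: "0 < \<kappa>" by simp
  have step: "0 < s n \<and> \<kappa> * s n \<le> s (Suc n)" for n
  proof (induction n)
    case 0
    then show ?case using s0 by (simp add: \<kappa>_def)
  next
    case (Suc n)
    then have pos: "0 < s (Suc n)" using \<kappa>0 mult_pos_pos[of \<kappa> "s n"] by linarith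
    have "\<kappa> * s n * s (Suc n) \<le> (s (Suc n))\<^sup>2"
      using Suc pos by (simp add: power2_eq_square)
    also have "\<dots> \<le> s n * s (Suc (Suc n))" by (rule conv)
    finally have "s n * (\<kappa> * s (Suc n)) \<le> s n * s (Suc (Suc n))" by (simp add: ac_simps)
    with Suc pos show ?case by simp
  qed
  have geom: "\<kappa> ^ n * s 0 \<le> s n" for n
  proof (induction n)
    case (Suc n)
    have "\<kappa> ^ Suc n * s 0 \<le> \<kappa> * s n" using Suc \<kappa>0 by simp
    with step[of n] show ?case by linarith
  qed simp
  show False
  proof (cases "\<rho> = 0")
    case True
    with bd[of 1] less nn[of 0] show False by simp
  next
    case False
    with \<open>0 \<le> \<rho>\<close> have \<rho>: "0 < \<rho>" by simp
    then have "1 < \<kappa> / \<rho>" using \<kappa> by simp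
    then obtain n where n: "C / s 0 < (\<kappa> / \<rho>) ^ n" using real_arch_pow by blast
    have "C / s 0 < (\<kappa> / \<rho>) ^ Suc n"
      using n \<open>1 < \<kappa> / \<rho>\<close> power_strict_increasing[of n "Suc n" "\<kappa> / \<rho>"] by simp
    then have "C * \<rho> ^ Suc n < \<kappa> ^ Suc n * s 0"
      using s0 \<rho> by (simp add: power_divide field_simps)
    with geom[of "Suc n"] bd[of "Suc n"] show False by simp
  qed
qed

lemma four_mult_le_square_add:
  fixes x y :: real shows "4 * (x * y) \<le> (x + y)\<^sup>2"
  using zero_le_power2[of "x - y"] by (simp add: power2_eq_square algebra_simps)

lemma two_term_Cauchy_Schwarz:
  fixes a b X Y P Q :: real
  assumes a: "a\<^sup>2 \<le> X * P" and b: "b\<^sup>2 \<le> Y * Q"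
    and nn: "0 \<le> X" "0 \<le> Y" "0 \<le> P" "0 \<le> Q"
  shows "(a + b)\<^sup>2 \<le> (X + Y) * (P + Q)"
proof -
  have "(2 * a * b)\<^sup>2 = 4 * (a\<^sup>2 * b\<^sup>2)" by (simp add: power_mult_distrib)
  also have "\<dots> \<le> 4 * ((X * P) * (Y * Q))"
    using a b nn by (intro mult_left_mono mult_mono) simp_all
  also have "\<dots> = 4 * ((X * Q) * (Y * P))" by simp
  also have "\<dots> \<le> (X * Q + Y * P)\<^sup>2" by (rule four_mult_le_square_add)
  finally have "2 * a * b \<le> X * Q + Y * P"
    by (rule power2_le_imp_le) (use nn in simp)
  with a b have "a\<^sup>2 + b\<^sup>2 + 2 * a * b \<le> X * P + Y * Q + (X * Q + Y * P)" by linarith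
  then show ?thesis by (simp add: power2_sum distrib_left distrib_right)
qed

text \<open>Here \<open>l\<close> is the larger root of \<open>(x - r) (x - (1 - r)) = r (1 - r) \<delta>\<close>, an equation whose
  discriminant can be written \<open>(1 - 2 r)\<^sup>2 + 4 r (1 - r) \<delta>\<close>. To the right of \<open>r\<close> and \<open>1 - r\<close> the
  quadratic is increasing, whence the minimality of \<open>l\<close>.\<close>

lemma quadratic_root_facts:
  fixes r \<delta> :: real
  assumes r: "0 < r" "r < 1" and \<delta>: "0 \<le> \<delta>" "\<delta> \<le> 1"
  defines "l \<equiv> (1 + sqrt (1 - 4 * r * (1 - r) * (1 - \<delta>))) / 2"
  shows "r \<le> l" "1 - r \<le> l" and "l \<le> 1"
    and "(l - r) * (l - (1 - r)) = r * (1 - r) * \<delta>"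
    and "r \<le> k \<Longrightarrow> 1 - r \<le> k \<Longrightarrow> r * (1 - r) * \<delta> \<le> (k - r) * (k - (1 - r)) \<Longrightarrow> l \<le> k"
proof -
  define D where "D = 1 - 4 * r * (1 - r) * (1 - \<delta>)"
  have l: "l = (1 + sqrt D) / 2" by (simp add: l_def D_def)
  have D_alt: "D = (1 - 2 * r)\<^sup>2 + 4 * (r * (1 - r) * \<delta>)"
    by (simp add: D_def power2_eq_square algebra_simps)
  have pos: "0 \<le> r * (1 - r) * \<delta>" "0 \<le> r * (1 - r) * (1 - \<delta>)" using r \<delta> by simp_all
  have "\<bar>1 - 2 * r\<bar> \<le> sqrt D"
    using pos by (intro real_le_rsqrt) (simp add: D_alt)
  then show "r \<le> l" "1 - r \<le> l" by (auto simp: l)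
  have "D \<le> 1" using pos(2) by (simp add: D_def mult.assoc)
  then show "l \<le> 1" by (simp add: l)
  have D0: "0 \<le> D" using pos by (simp add: D_alt)
  have prod: "4 * ((x - r) * (x - (1 - r))) = (2 * x - 1)\<^sup>2 - (1 - 2 * r)\<^sup>2" for x
    by (simp add: power2_eq_square algebra_simps)
  have "4 * ((l - r) * (l - (1 - r))) = D - (1 - 2 * r)\<^sup>2"
    unfolding prod using D0 by (simp add: l add_divide_distrib)
  then show "(l - r) * (l - (1 - r)) = r * (1 - r) * \<delta>" by (simp add: D_alt)
  assume k: "r \<le> k" "1 - r \<le> k" "r * (1 - r) * \<delta> \<le> (k - r) * (k - (1 - r))"
  then have "D \<le> (2 * k - 1)\<^sup>2" using prod[of k] by (simp add: D_alt)
  moreover have "0 \<le> 2 * k - 1" using k by simp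
  ultimately have "sqrt D \<le> 2 * k - 1" by (rule real_le_lsqrt[rotated])
  then show "l \<le> k" by (simp add: l)
qed

section \<open>Semi-inner products, symmetric operators and projections\<close>

text \<open>The form may be degenerate, so that \<open>L\<^sup>2\<close> functions can be used without passing to classes modulo
  null sets.\<close>

locale semi_inner_space =
  fixes V :: "('a \<Rightarrow> real) set" and ip :: "('a \<Rightarrow> real) \<Rightarrow> ('a \<Rightarrow> real) \<Rightarrow> real"
  assumes lincomb_in: "f \<in> V \<Longrightarrow> g \<in> V \<Longrightarrow> (\<lambda>z. a * f z + b * g z) \<in> V"
    and ip_lincomb_left: "f \<in> V \<Longrightarrow> g \<in> V \<Longrightarrow> h \<in> V
          \<Longrightarrow> ip (\<lambda>z. a * f z + b * g z) h = a * ip f h + b * ip g h"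
    and ip_commute: "ip f g = ip g f"
    and ip_nonneg: "0 \<le> ip f f"
begin

lemma ip_lincomb_right:
  "f \<in> V \<Longrightarrow> g \<in> V \<Longrightarrow> h \<in> V \<Longrightarrow> ip h (\<lambda>z. a * f z + b * g z) = a * ip h f + b * ip h g"
  using ip_lincomb_left[of f g h a b] by (simp add: ip_commute)

lemma ip_lincomb_self:
  assumes "f \<in> V" "g \<in> V"
  shows "ip (\<lambda>z. a * f z + b * g z) (\<lambda>z. a * f z + b * g z)
           = a\<^sup>2 * ip f f + 2 * a * b * ip f g + b\<^sup>2 * ip g g"
  using assms by (simp add: ip_lincomb_left ip_lincomb_right lincomb_in ip_commute[of g f]
      power2_eq_square algebra_simps)

lemma Cauchy_Schwarz: "f \<in> V \<Longrightarrow> g \<in> V \<Longrightarrow> (ip f g)\<^sup>2 \<le> ip f f * ip g g"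
proof (rule discriminant_nonpos[OF ip_nonneg])
  fix t assume fg: "f \<in> V" "g \<in> V"
  show "0 \<le> ip f f * t\<^sup>2 + 2 * ip f g * t + ip g g"
    using ip_nonneg[of "\<lambda>z. t * f z + 1 * g z"] ip_lincomb_self[OF fg, of t 1]
    by (simp add: algebra_simps)
qed

text \<open>By symmetry and Cauchy-Schwarz, \<open>\<parallel>S v\<parallel>\<^sup>2 = \<langle>v, S (S v)\<rangle> \<le> \<parallel>v\<parallel> \<parallel>S (S v)\<parallel>\<close>, so the norms along an
  orbit are log-convex. Symmetry is only asked for on an \<open>S\<close>-invariant set \<open>U\<close>: the product of two
  projections is symmetric on the range of one of them, but not on the whole space.\<close>

lemma selfadjoint_bound_of_orbit_bound:
  assumes U: "U \<subseteq> V" and S: "\<And>u. u \<in> U \<Longrightarrow> S u \<in> U"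
    and sym: "\<And>u v. u \<in> U \<Longrightarrow> v \<in> U \<Longrightarrow> ip (S u) v = ip u (S v)"
    and u: "u \<in> U" and \<rho>: "0 \<le> \<rho>"
    and bd: "\<And>n. 1 \<le> n \<Longrightarrow> sqrt (ip ((S ^^ n) u) ((S ^^ n) u)) \<le> C * \<rho> ^ n"
  shows "sqrt (ip (S u) (S u)) \<le> \<rho> * sqrt (ip u u)"
proof -
  define s where "s n = sqrt (ip ((S ^^ n) u) ((S ^^ n) u))" for n
  have in_U: "(S ^^ n) u \<in> U" for n by (induction n) (use u S in auto)
  have "(s (Suc n))\<^sup>2 \<le> s n * s (Suc (Suc n))" for n
  proof -
    define v where "v = (S ^^ n) u"
    have v: "v \<in> U" "S v \<in> U" "S (S v) \<in> U" using in_U[of n] S by (auto simp: v_def)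
    have "(s (Suc n))\<^sup>2 = ip (S v) (S v)"
      by (simp add: s_def v_def ip_nonneg)
    also have "\<dots> = ip v (S (S v))" using sym[of v "S v"] v by simp
    also have "\<dots> \<le> sqrt (ip v v * ip (S (S v)) (S (S v)))"
      using Cauchy_Schwarz[of v "S (S v)"] v U by (intro real_le_rsqrt) auto
    also have "\<dots> = s n * s (Suc (Suc n))"
      by (simp add: s_def v_def real_sqrt_mult)
    finally show ?thesis .
  qed
  from log_convex_first_ratio[of s C, OF _ this _ \<rho>] bd
  have "s 1 \<le> \<rho> * s 0" by (simp add: s_def ip_nonneg)
  then show ?thesis by (simp add: s_def)
qed

text \<open>Idempotence is stated after pairing with test functions, because conditional expectations
  satisfy it only up to null sets. Linearity, in the same weak sense, follows from symmetry.\<close>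

definition projection :: "(('a \<Rightarrow> real) \<Rightarrow> 'a \<Rightarrow> real) \<Rightarrow> bool" where
  "projection p \<longleftrightarrow> (\<forall>f\<in>V. p f \<in> V) \<and> (\<forall>f\<in>V. \<forall>g\<in>V. ip (p f) g = ip f (p g)) \<and>
     (\<forall>f\<in>V. \<forall>g\<in>V. ip (p (p f)) g = ip (p f) g)"

lemma projection_in: "projection p \<Longrightarrow> f \<in> V \<Longrightarrow> p f \<in> V"
  and projection_adjoint: "projection p \<Longrightarrow> f \<in> V \<Longrightarrow> g \<in> V \<Longrightarrow> ip (p f) g = ip f (p g)"
  and projection_idem: "projection p \<Longrightarrow> f \<in> V \<Longrightarrow> g \<in> V \<Longrightarrow> ip (p (p f)) g = ip (p f) g"
  by (auto simp: projection_def)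

lemma projection_ip_self:
  assumes "projection p" "f \<in> V" shows "ip (p f) (p f) = ip (p f) f"
  using assms by (metis projection_in projection_adjoint projection_idem)

lemma projection_contraction:
  assumes p: "projection p" and f: "f \<in> V" shows "ip (p f) (p f) \<le> ip f f"
proof -
  have "(ip (p f) (p f))\<^sup>2 \<le> ip (p f) (p f) * ip f f"
    using Cauchy_Schwarz[OF projection_in[OF p f] f] projection_ip_self[OF p f] by simp
  then show ?thesis
    using ip_nonneg[of "p f"] ip_nonneg[of f]
    by (cases "ip (p f) (p f) = 0") (auto simp: power2_eq_square)
qed

end

section \<open>Two projections\<close>

locale two_projections = semi_inner_space +
  fixes p q :: "('a \<Rightarrow> real) \<Rightarrow> 'a \<Rightarrow> real"
  assumes proj_p: "projection p" and proj_q: "projection q"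
begin

lemmas p_in = projection_in[OF proj_p] and q_in = projection_in[OF proj_q]
lemmas p_adj = projection_adjoint[OF proj_p] and q_adj = projection_adjoint[OF proj_q]
lemmas p_idem = projection_idem[OF proj_p] and q_idem = projection_idem[OF proj_q]

text \<open>For conditional expectations on mean-zero functions, the least such \<open>c\<close> is the square of the
  maximal correlation of the two conditioning variables.\<close>

definition correlation_bound :: "real \<Rightarrow> bool" where
  "correlation_bound c \<longleftrightarrow> (\<forall>f\<in>V. \<forall>g\<in>V. (ip (p f) (q g))\<^sup>2 \<le> c * (ip f f * ip g g))"

lemma correlation_bound_on_ranges:
  assumes "correlation_bound c" "f \<in> V" "g \<in> V"
  shows "(ip (p f) (q g))\<^sup>2 \<le> c * (ip (p f) (p f) * ip (q g) (q g))"
proof -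
  have "ip (p (p f)) (q (q g)) = ip (p f) (q (q g))" using assms by (simp add: p_idem p_in q_in)
  also have "\<dots> = ip (p f) (q g)"
    using q_idem[of g "p f"] assms by (simp add: ip_commute p_in)
  finally show ?thesis
    using assms(1)[unfolded correlation_bound_def, rule_format, of "p f" "q g"] assms
    by (simp add: p_in q_in)
qed

text \<open>The range of \<open>p\<close>, up to elements of seminorm zero.\<close>

definition range_p :: "('a \<Rightarrow> real) set" where
  "range_p = {u \<in> V. \<forall>f\<in>V. ip (p u) f = ip u f}"

definition range_q :: "('a \<Rightarrow> real) set" where
  "range_q = {u \<in> V. \<forall>f\<in>V. ip (q u) f = ip u f}"

lemma p_in_range: "f \<in> V \<Longrightarrow> p f \<in> range_p"
  by (simp add: range_p_def p_in p_idem)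

lemma q_in_range: "f \<in> V \<Longrightarrow> q f \<in> range_q"
  by (simp add: range_q_def q_in q_idem)

text \<open>For \<open>u\<close> in the range of \<open>p\<close>, \<open>\<parallel>q u\<parallel>\<^sup>2 = \<langle>p u, q u\<rangle>\<close>, to which the correlation bound applies.\<close>

lemma q_on_range_p:
  assumes c: "correlation_bound c" "0 \<le> c" and u: "u \<in> range_p"
  shows "ip (q u) (q u) \<le> c * ip u u"
proof -
  have uV: "u \<in> V" using u by (simp add: range_p_def)
  have "ip (q u) (q u) = ip (p u) (q u)"
    using u uV by (simp add: range_p_def projection_ip_self[OF proj_q] ip_commute[of "q u" u] q_in)
  then have "(ip (q u) (q u))\<^sup>2 \<le> c * (ip (p u) (p u) * ip (q u) (q u))"
    using correlation_bound_on_ranges[OF c(1) uV uV] by metis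
  then have "ip (q u) (q u) \<le> c * ip (p u) (p u)"
    using ip_nonneg[of "q u"] ip_nonneg[of "p u"] c
    by (cases "ip (q u) (q u) = 0") (auto simp: power2_eq_square)
  also have "\<dots> \<le> c * ip u u"
    using projection_contraction[OF proj_p uV] c by (simp add: mult_left_mono)
  finally show ?thesis .
qed

lemma swap_projections: "two_projections V ip q p"
  by unfold_locales (simp_all add: proj_p proj_q)

lemma p_on_range_q:
  assumes c: "correlation_bound c" "0 \<le> c" and u: "u \<in> range_q"
  shows "ip (p u) (p u) \<le> c * ip u u"
proof -
  interpret sw: two_projections V ip q p by (rule swap_projections)
  have "sw.correlation_bound c"
    unfolding sw.correlation_bound_def
  proof (intro ballI)
    fix f g assume "f \<in> V" "g \<in> V"
    with c show "(ip (q f) (p g))\<^sup>2 \<le> c * (ip f f * ip g g)"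
      by (simp add: correlation_bound_def ip_commute[of "q f"] mult.commute[of "ip f f"])
  qed
  moreover have "u \<in> sw.range_p"
    using u by (simp add: sw.range_p_def range_q_def)
  ultimately show ?thesis using sw.q_on_range_p c by blast
qed

lemma correlation_bound_1: "correlation_bound 1"
  unfolding correlation_bound_def
proof (intro ballI)
  fix f g assume fg: "f \<in> V" "g \<in> V"
  have "(ip (p f) (q g))\<^sup>2 \<le> ip (p f) (p f) * ip (q g) (q g)"
    using fg by (intro Cauchy_Schwarz p_in q_in)
  also have "\<dots> \<le> ip f f * ip g g"
    using fg by (intro mult_mono projection_contraction proj_p proj_q ip_nonneg)
  finally show "(ip (p f) (q g))\<^sup>2 \<le> 1 * (ip f f * ip g g)" by simp
qed

text \<open>Once the orbit has entered the range of \<open>p\<close>, each application of \<open>q\<close> and each application of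
  \<open>p\<close> multiplies the squared norm by at most \<open>c\<close>, so that one step of \<open>p \<circ> q\<close> multiplies the norm
  by at most \<open>c\<close>. The first step only serves to enter the range; it is what the division by \<open>c\<close> pays for.\<close>

lemma alternating_orbit_bound:
  assumes c: "correlation_bound c" "0 < c" and g: "g \<in> V" and n: "1 \<le> n"
  shows "sqrt (ip (((p \<circ> q) ^^ n) g) (((p \<circ> q) ^^ n) g)) \<le> sqrt (ip g g) / c * c ^ n"
proof -
  have Suc_o: "((p \<circ> q) ^^ Suc m) g = p (q (((p \<circ> q) ^^ m) g))" for m by simp
  have step: "((p \<circ> q) ^^ Suc n) g \<in> range_p \<and>
      ip (((p \<circ> q) ^^ Suc n) g) (((p \<circ> q) ^^ Suc n) g) \<le> (c ^ n)\<^sup>2 * ip g g" for n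
  proof (induction n)
    case 0
    have "ip (p (q g)) (p (q g)) \<le> ip g g"
      using projection_contraction[OF proj_p q_in[OF g]] projection_contraction[OF proj_q g]
      by linarith
    then show ?case using g by (simp add: p_in_range q_in)
  next
    case (Suc n)
    define u where "u = ((p \<circ> q) ^^ Suc n) g"
    have u: "u \<in> range_p" "u \<in> V"
      using Suc unfolding u_def range_p_def by blast+
    have "ip (p (q u)) (p (q u)) \<le> c * ip (q u) (q u)"
      using c u by (intro p_on_range_q q_in_range) simp_all
    also have "\<dots> \<le> c * (c * ip u u)"
      using c u by (intro mult_left_mono q_on_range_p) simp_all
    also have "\<dots> \<le> c * (c * ((c ^ n)\<^sup>2 * ip g g))"
      using c Suc[THEN conjunct2] unfolding u_def by (intro mult_left_mono) (assumption | simp)+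
    also have "\<dots> = (c ^ Suc n)\<^sup>2 * ip g g" by (simp add: power2_eq_square)
    finally show ?case
      using u unfolding Suc_o[of "Suc n"] u_def[symmetric] by (simp add: p_in_range q_in)
  qed
  obtain m where m: "n = Suc m" using n by (cases n) auto
  have "sqrt (ip (((p \<circ> q) ^^ n) g) (((p \<circ> q) ^^ n) g)) \<le> sqrt ((c ^ m)\<^sup>2 * ip g g)"
    using step[of m] by (simp only: m real_sqrt_le_iff)
  also have "\<dots> = sqrt (ip g g) / c * c ^ n"
    using c by (simp add: m real_sqrt_mult)
  finally show ?thesis .
qed

text \<open>On the range of \<open>p\<close> the operator \<open>p \<circ> q\<close> is symmetric, so the orbit bounds give
  \<open>\<parallel>p (q u)\<parallel> \<le> \<rho> \<parallel>u\<parallel>\<close> there. Since \<open>\<parallel>q u\<parallel>\<^sup>2 = \<langle>u, p (q u)\<rangle>\<close>, this bounds \<open>\<parallel>q (p f)\<parallel>\<^sup>2\<close> by \<open>\<rho> \<parallel>f\<parallel>\<^sup>2\<close>,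
  and \<open>\<langle>p f, q g\<rangle> = \<langle>q (p f), g\<rangle>\<close>.\<close>

lemma correlation_bound_of_alternating_orbit_bound:
  assumes bd: "\<And>g. g \<in> V \<Longrightarrow>
      \<exists>C. \<forall>n\<ge>1. sqrt (ip (((p \<circ> q) ^^ n) g) (((p \<circ> q) ^^ n) g)) \<le> C * \<rho> ^ n"
    and \<rho>: "0 \<le> \<rho>"
  shows "correlation_bound \<rho>"
  unfolding correlation_bound_def
proof (intro ballI)
  fix f g assume f: "f \<in> V" and g: "g \<in> V"
  define u where "u = p f"
  have u: "u \<in> range_p" "u \<in> V" using f by (simp_all add: u_def p_in_range p_in)
  have sym: "ip ((p \<circ> q) v) w = ip v ((p \<circ> q) w)" if "v \<in> range_p" "w \<in> range_p" for v w
  proof -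
    have vw: "v \<in> V" "w \<in> V" using that by (simp_all add: range_p_def)
    have "ip (p (q v)) w = ip (p w) (q v)" using vw by (simp add: p_adj q_in ip_commute)
    also have "\<dots> = ip w (q v)" using that vw by (simp add: range_p_def q_in)
    also have "\<dots> = ip v (q w)" using vw by (simp add: ip_commute[of w] q_adj)
    also have "\<dots> = ip (p v) (q w)" using that vw by (simp add: range_p_def q_in)
    also have "\<dots> = ip v (p (q w))" using vw by (simp add: p_adj q_in)
    finally show ?thesis by simp
  qed
  obtain C where "\<forall>n\<ge>1. sqrt (ip (((p \<circ> q) ^^ n) u) (((p \<circ> q) ^^ n) u)) \<le> C * \<rho> ^ n"
    using bd[OF u(2)] by blast
  then have "sqrt (ip ((p \<circ> q) u) ((p \<circ> q) u)) \<le> \<rho> * sqrt (ip u u)"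
  proof (intro selfadjoint_bound_of_orbit_bound[where U = range_p and C = C] sym u \<rho>)
    show "range_p \<subseteq> V" by (auto simp: range_p_def)
    show "(p \<circ> q) v \<in> range_p" if "v \<in> range_p" for v
      using that by (simp add: range_p_def q_in p_in p_idem)
  qed blast+
  then have pq: "sqrt (ip (p (q u)) (p (q u))) \<le> \<rho> * sqrt (ip u u)" by simp
  have "ip (q u) (q u) = ip (q u) u" by (rule projection_ip_self[OF proj_q u(2)])
  also have "\<dots> = ip (p u) (q u)" using u by (simp add: range_p_def ip_commute[of "q u"] q_in)
  also have "\<dots> = ip u (p (q u))" using u by (simp add: p_adj q_in)
  also have "\<dots> \<le> sqrt (ip u u * ip (p (q u)) (p (q u)))"
    using u by (intro real_le_rsqrt Cauchy_Schwarz p_in q_in)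
  also have "\<dots> = sqrt (ip u u) * sqrt (ip (p (q u)) (p (q u)))" by (rule real_sqrt_mult)
  also have "\<dots> \<le> sqrt (ip u u) * (\<rho> * sqrt (ip u u))"
    using pq by (intro mult_left_mono) (simp_all add: ip_nonneg)
  also have "\<dots> = \<rho> * ip u u" by (simp add: ip_nonneg)
  also have "\<dots> \<le> \<rho> * ip f f"
    using projection_contraction[OF proj_p f] \<rho> by (simp add: u_def mult_left_mono)
  finally have qu: "ip (q u) (q u) \<le> \<rho> * ip f f" .
  have "(ip (p f) (q g))\<^sup>2 = (ip (q u) g)\<^sup>2" using u g by (simp add: u_def q_adj)
  also have "\<dots> \<le> ip (q u) (q u) * ip g g" using u g by (intro Cauchy_Schwarz q_in)
  also have "\<dots> \<le> \<rho> * ip f f * ip g g" using qu by (intro mult_right_mono ip_nonneg)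
  finally show "(ip (p f) (q g))\<^sup>2 \<le> \<rho> * (ip f f * ip g g)" by (simp add: ac_simps)
qed

definition mixture :: "real \<Rightarrow> ('a \<Rightarrow> real) \<Rightarrow> 'a \<Rightarrow> real" where
  "mixture r g = (\<lambda>z. r * p g z + (1 - r) * q g z)"

lemma mixture_in: "g \<in> V \<Longrightarrow> mixture r g \<in> V"
  by (simp add: mixture_def lincomb_in p_in q_in)

lemma mixture_adj: "f \<in> V \<Longrightarrow> g \<in> V \<Longrightarrow> ip (mixture r f) g = ip f (mixture r g)"
  by (simp add: mixture_def ip_lincomb_left ip_lincomb_right p_in q_in p_adj q_adj)

lemma ip_mixture_self:
  "g \<in> V \<Longrightarrow> ip (mixture r g) g = r * ip (p g) (p g) + (1 - r) * ip (q g) (q g)"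
  by (simp add: mixture_def ip_lincomb_left p_in q_in projection_ip_self[OF proj_p]
      projection_ip_self[OF proj_q])

text \<open>For \<open>c \<ge> 0\<close> the hypotheses on \<open>l\<close> say that the quadratic form
  \<open>l (r s\<^sup>2 + (1 - r) t\<^sup>2) - (r\<^sup>2 s\<^sup>2 + (1 - r)\<^sup>2 t\<^sup>2 + 2 r (1 - r) sqrt c s t)\<close> is positive
  semidefinite. It is evaluated at \<open>s = \<parallel>p g\<parallel>\<close> and \<open>t = \<parallel>q g\<parallel>\<close>. Writing \<open>T\<close> for the mixture, this
  yields \<open>\<parallel>T g\<parallel>\<^sup>2 \<le> l \<langle>T g, g\<rangle>\<close>, and Cauchy-Schwarz finishes the proof.\<close>

lemma mixture_contraction:
  assumes c: "correlation_bound c" and r: "0 < r" "r < 1"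
    and l: "r \<le> l" "1 - r \<le> l" "r * (1 - r) * c \<le> (l - r) * (l - (1 - r))"
    and g: "g \<in> V"
  shows "sqrt (ip (mixture r g) (mixture r g)) \<le> l * sqrt (ip g g)"
proof -
  define a b where "a = ip (p g) (p g)" and "b = ip (q g) (q g)"
  define e where "e = ip (p g) (q g)"
  define T where "T = mixture r g"
  have ab: "0 \<le> a" "0 \<le> b" by (simp_all add: a_def b_def ip_nonneg)
  have e: "e\<^sup>2 \<le> c * (a * b)"
    using correlation_bound_on_ranges[OF c g g] by (simp add: a_def b_def e_def)
  have key: "2 * (r * (1 - r)) * e \<le> r * (l - r) * a + (1 - r) * (l - (1 - r)) * b"
  proof -
    define x y where "x = r * (l - r) * a" and "y = (1 - r) * (l - (1 - r)) * b"
    have xy: "0 \<le> x" "0 \<le> y" using r l ab by (simp_all add: x_def y_def)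
    have "(2 * (r * (1 - r) * e))\<^sup>2 = 4 * (r * (1 - r))\<^sup>2 * e\<^sup>2"
      by (simp only: power_mult_distrib) simp
    also have "\<dots> \<le> 4 * (r * (1 - r))\<^sup>2 * (c * (a * b))"
      using e by (rule mult_left_mono) simp
    also have "\<dots> = 4 * (r * (1 - r) * (a * b)) * (r * (1 - r) * c)"
      by (simp only: power2_eq_square ac_simps)
    also have "\<dots> \<le> 4 * (r * (1 - r) * (a * b)) * ((l - r) * (l - (1 - r)))"
      using r ab by (intro mult_left_mono l) simp_all
    also have "\<dots> = 4 * (x * y)" by (simp only: x_def y_def ac_simps)
    also have "\<dots> \<le> (x + y)\<^sup>2" by (rule four_mult_le_square_add)
    finally have "2 * (r * (1 - r) * e) \<le> x + y"
      by (rule power2_le_imp_le) (use xy in simp)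
    then show ?thesis unfolding x_def y_def by linarith
  qed
  have "ip T T = r\<^sup>2 * a + 2 * r * (1 - r) * e + (1 - r)\<^sup>2 * b"
    using ip_lincomb_self[OF p_in[OF g] q_in[OF g]]
    by (simp add: T_def mixture_def a_def b_def e_def)
  also have "\<dots> \<le> l * (r * a + (1 - r) * b)"
    using key by (simp add: power2_eq_square algebra_simps)
  also have "\<dots> = l * ip T g"
    by (simp add: T_def ip_mixture_self g a_def b_def)
  finally have TT: "ip T T \<le> l * ip T g" .
  have "ip T g \<le> sqrt (ip T T * ip g g)"
    using g by (intro real_le_rsqrt Cauchy_Schwarz) (simp_all add: T_def mixture_in)
  with TT have "ip T T \<le> l * (sqrt (ip T T) * sqrt (ip g g))"
    using r l by (simp add: real_sqrt_mult order_trans mult_left_mono)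
  then have *: "sqrt (ip T T) * sqrt (ip T T) \<le> sqrt (ip T T) * (l * sqrt (ip g g))"
    by (simp add: ip_nonneg ac_simps)
  show ?thesis
  proof (cases "ip T T = 0")
    case True
    then show ?thesis using r l by (simp add: ip_nonneg T_def)
  next
    case False
    then have "0 < sqrt (ip T T)" using ip_nonneg[of T] by simp
    from mult_left_le_imp_le[OF * this] show ?thesis by (simp add: T_def)
  qed
qed

lemma mixture_form_bound:
  assumes T: "sqrt (ip (mixture r g) (mixture r g)) \<le> l * sqrt (ip g g)" and g: "g \<in> V"
  shows "ip (mixture r g) g \<le> l * ip g g"
proof -
  have "ip (mixture r g) g \<le> sqrt (ip (mixture r g) (mixture r g) * ip g g)"
    using g by (intro real_le_rsqrt Cauchy_Schwarz mixture_in)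
  also have "\<dots> \<le> l * sqrt (ip g g) * sqrt (ip g g)"
    unfolding real_sqrt_mult using T by (intro mult_right_mono) (simp_all add: ip_nonneg)
  finally show ?thesis by (simp add: ip_nonneg mult.assoc)
qed

text \<open>On a nonzero vector in the range of \<open>p\<close>, the form \<open>r \<parallel>p w\<parallel>\<^sup>2 + (1 - r) \<parallel>q w\<parallel>\<^sup>2\<close> is at least
  \<open>r \<parallel>w\<parallel>\<^sup>2\<close>.\<close>

lemma mixture_bound_ge_weight:
  assumes r: "r < 1"
    and T: "\<And>g. g \<in> V \<Longrightarrow> sqrt (ip (mixture r g) (mixture r g)) \<le> l * sqrt (ip g g)"
    and u: "u \<in> V" "0 < ip (p u) (p u)"
  shows "r \<le> l"
proof -
  define w where "w = p u"
  have w: "w \<in> V" "0 < ip w w" using u by (simp_all add: w_def p_in)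
  have "ip (p w) (p w) = ip (p w) w" by (rule projection_ip_self[OF proj_p w(1)])
  also have "\<dots> = ip w w" using u by (simp add: w_def p_in p_idem)
  finally have pw: "ip (p w) (p w) = ip w w" .
  have "r * ip w w \<le> ip (mixture r w) w"
    using r ip_nonneg[of "q w"] by (simp add: ip_mixture_self w pw)
  also have "\<dots> \<le> l * ip w w" by (rule mixture_form_bound[OF T[OF w(1)] w(1)])
  finally show ?thesis using w by simp
qed

text \<open>The mixture is \<open>R\<^sup>* R\<close> for the map \<open>R g = (sqrt r p g, sqrt (1 - r) q g)\<close> into pairs, and
  \<open>R R\<^sup>*\<close> has the same bound as \<open>R\<^sup>* R\<close>. The inequality is \<open>\<parallel>R\<^sup>* w\<parallel>\<^sup>2 \<le> l \<parallel>w\<parallel>\<^sup>2\<close> for the pair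
  \<open>w = (t p u, q v)\<close>.\<close>

lemma mixture_bound_on_pairs:
  assumes r: "0 < r" "r < 1"
    and T: "\<And>g. g \<in> V \<Longrightarrow> sqrt (ip (mixture r g) (mixture r g)) \<le> l * sqrt (ip g g)"
    and l: "0 \<le> l" and u: "u \<in> V" and v: "v \<in> V"
  shows "r * (t\<^sup>2 * ip (p u) (p u)) + (1 - r) * ip (q v) (q v)
           + 2 * (sqrt (r * (1 - r)) * t) * ip (p u) (q v)
         \<le> l * (t\<^sup>2 * ip (p u) (p u) + ip (q v) (q v))"
proof -
  define g where "g = (\<lambda>z. (t * sqrt r) * p u z + sqrt (1 - r) * q v z)"
  have g: "g \<in> V" using u v by (simp add: g_def lincomb_in p_in q_in)
  define N where "N = t\<^sup>2 * ip (p u) (p u) + ip (q v) (q v)"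
  have gg: "ip g g = r * (t\<^sup>2 * ip (p u) (p u)) + (1 - r) * ip (q v) (q v)
      + 2 * (sqrt (r * (1 - r)) * t) * ip (p u) (q v)"
    unfolding g_def ip_lincomb_self[OF p_in[OF u] q_in[OF v]] using r
    by (simp add: real_sqrt_mult power_mult_distrib)
  have "ip g g = t * sqrt r * ip (p u) g + sqrt (1 - r) * ip (q v) g"
    using ip_lincomb_left[OF p_in[OF u] q_in[OF v] g] by (simp add: g_def)
  also have "ip (p u) g = ip (p u) (p g)"
    using u g p_idem[of u g] by (simp add: p_adj p_in)
  also have "ip (q v) g = ip (q v) (q g)"
    using v g q_idem[of v g] by (simp add: q_adj q_in)
  finally have split: "ip g g = t * sqrt r * ip (p u) (p g) + sqrt (1 - r) * ip (q v) (q g)" .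
  have "(ip g g)\<^sup>2 \<le> N * ((sqrt r)\<^sup>2 * ip (p g) (p g) + (sqrt (1 - r))\<^sup>2 * ip (q g) (q g))"
    unfolding split N_def
  proof (rule two_term_Cauchy_Schwarz)
    show "(t * sqrt r * ip (p u) (p g))\<^sup>2
        \<le> t\<^sup>2 * ip (p u) (p u) * ((sqrt r)\<^sup>2 * ip (p g) (p g))"
      using mult_left_mono[OF Cauchy_Schwarz[OF p_in[OF u] p_in[OF g]], of "(t * sqrt r)\<^sup>2"]
      by (simp add: power_mult_distrib ac_simps)
    show "(sqrt (1 - r) * ip (q v) (q g))\<^sup>2
        \<le> ip (q v) (q v) * ((sqrt (1 - r))\<^sup>2 * ip (q g) (q g))"
      using mult_left_mono[OF Cauchy_Schwarz[OF q_in[OF v] q_in[OF g]], of "(sqrt (1 - r))\<^sup>2"]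
      by (simp add: power_mult_distrib ac_simps)
  qed (simp_all add: ip_nonneg)
  also have "\<dots> = N * ip (mixture r g) g"
    using r g by (simp add: ip_mixture_self)
  finally have "(ip g g)\<^sup>2 \<le> N * ip (mixture r g) g" .
  also have "\<dots> \<le> N * (l * ip g g)"
    by (rule mult_left_mono[OF mixture_form_bound[OF T[OF g] g]]) (simp add: N_def ip_nonneg)
  finally have "ip g g * ip g g \<le> ip g g * (l * N)"
    by (simp add: power2_eq_square ac_simps)
  then have "ip g g \<le> l * N \<or> ip g g = 0"
    using ip_nonneg[of g] by (cases "ip g g = 0") auto
  moreover have "0 \<le> l * N" using l by (simp add: N_def ip_nonneg)
  ultimately have "ip g g \<le> l * N" by auto
  then show ?thesis unfolding gg N_def .
qed

text \<open>The estimate on pairs, for all \<open>t\<close>, says that a quadratic polynomial in \<open>t\<close> is nonnegative. Its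
  discriminant condition is the correlation bound.\<close>

lemma correlation_bound_of_mixture_bound:
  assumes r: "0 < r" "r < 1"
    and T: "\<And>g. g \<in> V \<Longrightarrow> sqrt (ip (mixture r g) (mixture r g)) \<le> l * sqrt (ip g g)"
    and l: "r \<le> l" "1 - r \<le> l"
  shows "correlation_bound ((l - r) * (l - (1 - r)) / (r * (1 - r)))"
  unfolding correlation_bound_def
proof (intro ballI)
  fix f g assume f: "f \<in> V" and g: "g \<in> V"
  define a b e where "a = ip (p f) (p f)" and "b = ip (q g) (q g)" and "e = ip (p f) (q g)"
  have ab: "0 \<le> a" "0 \<le> b" by (simp_all add: a_def b_def ip_nonneg)
  have "(- (sqrt (r * (1 - r)) * e))\<^sup>2 \<le> ((l - r) * a) * ((l - (1 - r)) * b)"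
  proof (rule discriminant_nonpos)
    fix t
    have "r * (t\<^sup>2 * a) + (1 - r) * b + 2 * (sqrt (r * (1 - r)) * t) * e \<le> l * (t\<^sup>2 * a + b)"
      using mixture_bound_on_pairs[OF r T _ f g, of t] r l by (simp add: a_def b_def e_def)
    then show "0 \<le> (l - r) * a * t\<^sup>2 + 2 * - (sqrt (r * (1 - r)) * e) * t + (l - (1 - r)) * b"
      by (simp add: algebra_simps)
  qed (use l ab in simp)
  then have "r * (1 - r) * e\<^sup>2 \<le> (l - r) * (l - (1 - r)) * (a * b)"
    using r by (simp add: power_mult_distrib ac_simps)
  also have "\<dots> \<le> (l - r) * (l - (1 - r)) * (ip f f * ip g g)"
    using f g l ab unfolding a_def b_def
    by (intro mult_left_mono mult_mono projection_contraction proj_p proj_q ip_nonneg) simp_all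
  finally show "(ip (p f) (q g))\<^sup>2 \<le> (l - r) * (l - (1 - r)) / (r * (1 - r)) * (ip f f * ip g g)"
    using r by (simp add: e_def field_simps)
qed

end

section \<open>Square-integrable functions and Markov kernels\<close>

text \<open>Fubini's theorem for kernels and integrands that need not be bounded: it is reduced to the
  positive and the negative part, whose inner integrals are finite almost everywhere.\<close>

lemma
  fixes f :: "'b \<Rightarrow> real"
  assumes K: "K \<in> M \<rightarrow>\<^sub>M prob_algebra N" and f: "f \<in> borel_measurable N"
    and M: "space M \<noteq> {}"
    and fin: "(\<integral>\<^sup>+x. \<integral>\<^sup>+y. ennreal \<bar>f y\<bar> \<partial>K x \<partial>M) < \<infinity>"
  shows AE_integrable_kernel: "AE x in M. integrable (K x) f"
    and integral_bind_integrable: "(\<integral>y. f y \<partial>(M \<bind> K)) = (\<integral>x. \<integral>y. f y \<partial>K x \<partial>M)"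
proof -
  note K' [measurable] = measurable_prob_algebraD[OF K]
  note f [measurable]
  have sK: "sets (K x) = sets N" if "x \<in> space M" for x
    using measurable_space[OF K that] by (simp add: space_prob_algebra)
  have fK: "f \<in> borel_measurable (K x)" if "x \<in> space M" for x
    using f sK[OF that] by (simp cong: measurable_cong_sets)
  have sb: "sets (M \<bind> K) = sets N" using sK M by (rule sets_bind)
  have fb: "f \<in> borel_measurable (M \<bind> K)"
    using f sb by (simp cong: measurable_cong_sets)
  have nnb: "(\<integral>\<^sup>+y. g y \<partial>(M \<bind> K)) = (\<integral>\<^sup>+x. \<integral>\<^sup>+y. g y \<partial>K x \<partial>M)"
    if "g \<in> borel_measurable N" for g by (rule nn_integral_bind[OF that K'])
  have int: "integrable (M \<bind> K) f"
    using fin nnb[of "\<lambda>y. ennreal \<bar>f y\<bar>"] fb by (intro integrableI_bounded) auto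
  have [measurable]: "(\<lambda>x. \<integral>\<^sup>+y. g y \<partial>K x) \<in> borel_measurable M"
    if "g \<in> borel_measurable N" for g
    by (rule measurable_compose[OF K' nn_integral_measurable_subprob_algebra[OF that]])
  have "AE x in M. (\<integral>\<^sup>+y. ennreal \<bar>f y\<bar> \<partial>K x) \<noteq> \<infinity>"
    using fin by (intro nn_integral_PInf_AE) auto
  then show ae: "AE x in M. integrable (K x) f"
  proof (rule AE_mp, intro AE_I2 impI)
    fix x assume "x \<in> space M" "(\<integral>\<^sup>+y. ennreal \<bar>f y\<bar> \<partial>K x) \<noteq> \<infinity>"
    then show "integrable (K x) f"
      using fK by (intro integrableI_bounded) (auto simp: less_top)
  qed
  have meas: "(\<lambda>x. \<integral>y. f y \<partial>K x) \<in> borel_measurable M"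
    by (rule measurable_compose[OF K' integral_measurable_subprob_algebra[OF f]])
  have part: "integrable M (\<lambda>x. enn2real (\<integral>\<^sup>+y. ennreal (g y) \<partial>K x)) \<and>
      enn2real (\<integral>\<^sup>+y. ennreal (g y) \<partial>(M \<bind> K)) = (\<integral>x. enn2real (\<integral>\<^sup>+y. ennreal (g y) \<partial>K x) \<partial>M)"
    if g [measurable]: "g \<in> borel_measurable N" and gf: "\<And>y. g y \<le> \<bar>f y\<bar>" for g
  proof -
    have "(\<integral>\<^sup>+x. \<integral>\<^sup>+y. ennreal (g y) \<partial>K x \<partial>M) \<le> (\<integral>\<^sup>+x. \<integral>\<^sup>+y. ennreal \<bar>f y\<bar> \<partial>K x \<partial>M)"
      by (intro nn_integral_mono ennreal_leI gf)
    also note fin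
    finally have gfin: "(\<integral>\<^sup>+x. \<integral>\<^sup>+y. ennreal (g y) \<partial>K x \<partial>M) < \<infinity>" .
    then have "AE x in M. (\<integral>\<^sup>+y. ennreal (g y) \<partial>K x) \<noteq> \<infinity>"
      by (intro nn_integral_PInf_AE) auto
    then have "AE x in M. ennreal (enn2real (\<integral>\<^sup>+y. ennreal (g y) \<partial>K x)) = (\<integral>\<^sup>+y. ennreal (g y) \<partial>K x)"
      by eventually_elim (simp add: less_top)
    then have eq: "(\<integral>\<^sup>+x. ennreal (enn2real (\<integral>\<^sup>+y. ennreal (g y) \<partial>K x)) \<partial>M)
        = (\<integral>\<^sup>+x. \<integral>\<^sup>+y. ennreal (g y) \<partial>K x \<partial>M)"
      by (rule nn_integral_cong_AE)
    have "integrable M (\<lambda>x. enn2real (\<integral>\<^sup>+y. ennreal (g y) \<partial>K x))"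
      using gfin by (intro integrableI_nonneg) (auto simp: eq)
    moreover have "(\<integral>x. enn2real (\<integral>\<^sup>+y. ennreal (g y) \<partial>K x) \<partial>M)
        = enn2real (\<integral>\<^sup>+y. ennreal (g y) \<partial>(M \<bind> K))"
      by (subst integral_eq_nn_integral) (auto simp: eq nnb)
    ultimately show ?thesis by simp
  qed
  have pf: "(\<lambda>y. f y) \<in> borel_measurable N" and nf: "(\<lambda>y. - f y) \<in> borel_measurable N" by auto
  note p = part[OF pf] and n = part[OF nf]
  have dec: "AE x in M. (\<integral>y. f y \<partial>K x)
      = enn2real (\<integral>\<^sup>+y. ennreal (f y) \<partial>K x) - enn2real (\<integral>\<^sup>+y. ennreal (- f y) \<partial>K x)"
    using ae by eventually_elim (rule real_lebesgue_integral_def)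
  have "(\<integral>x. \<integral>y. f y \<partial>K x \<partial>M)
      = (\<integral>x. enn2real (\<integral>\<^sup>+y. ennreal (f y) \<partial>K x) - enn2real (\<integral>\<^sup>+y. ennreal (- f y) \<partial>K x) \<partial>M)"
    by (rule integral_cong_AE[OF meas _ dec]) auto
  also have "\<dots> = (\<integral>y. f y \<partial>(M \<bind> K))"
    using p n by (simp add: real_lebesgue_integral_def[OF int])
  finally show "(\<integral>y. f y \<partial>(M \<bind> K)) = (\<integral>x. \<integral>y. f y \<partial>K x \<partial>M)" by simp
qed

lemma L2_funD: "f \<in> L2_fun M \<Longrightarrow> f \<in> borel_measurable M" "f \<in> L2_fun M \<Longrightarrow> integrable M (\<lambda>z. (f z)\<^sup>2)"
  by (simp_all add: L2_fun_def)

lemma abs_mult_le_sum_squares: fixes a b :: real shows "\<bar>a * b\<bar> \<le> a\<^sup>2 + b\<^sup>2"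
proof -
  have "2 * (\<bar>a\<bar> * \<bar>b\<bar>) \<le> a\<^sup>2 + b\<^sup>2"
    using zero_le_power2[of "\<bar>a\<bar> - \<bar>b\<bar>"] by (simp add: power2_diff)
  moreover have "0 \<le> \<bar>a\<bar> * \<bar>b\<bar>" by simp
  ultimately show ?thesis unfolding abs_mult by linarith
qed

lemma integrable_L2_mult:
  assumes "f \<in> L2_fun M" "g \<in> L2_fun M" shows "integrable M (\<lambda>z. f z * g z)"
proof (rule Bochner_Integration.integrable_bound)
  show "integrable M (\<lambda>z. (f z)\<^sup>2 + (g z)\<^sup>2)" using assms by (simp add: L2_funD)
  show "(\<lambda>z. f z * g z) \<in> borel_measurable M"
    using assms by (intro borel_measurable_times L2_funD)
  show "AE z in M. norm (f z * g z) \<le> norm ((f z)\<^sup>2 + (g z)\<^sup>2)"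
    using abs_mult_le_sum_squares by (intro AE_I2) (simp add: sum_power2_ge_zero)
qed

lemma L2_fun_lincomb:
  assumes "f \<in> L2_fun M" "g \<in> L2_fun M" shows "(\<lambda>z. a * f z + b * g z) \<in> L2_fun M"
proof -
  have "integrable M (\<lambda>z. a\<^sup>2 * (f z)\<^sup>2 + 2 * a * b * (f z * g z) + b\<^sup>2 * (g z)\<^sup>2)"
    using assms by (intro Bochner_Integration.integrable_add integrable_mult_right
        integrable_L2_mult) (simp_all add: L2_funD)
  also have "(\<lambda>z. a\<^sup>2 * (f z)\<^sup>2 + 2 * a * b * (f z * g z) + b\<^sup>2 * (g z)\<^sup>2)
      = (\<lambda>z. (a * f z + b * g z)\<^sup>2)"
    by (auto simp: power2_eq_square algebra_simps)
  finally have "integrable M (\<lambda>z. (a * f z + b * g z)\<^sup>2)" .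
  moreover have "(\<lambda>z. a * f z + b * g z) \<in> borel_measurable M"
    using assms by (intro borel_measurable_add borel_measurable_times borel_measurable_const L2_funD)
  ultimately show ?thesis by (simp add: L2_fun_def)
qed

lemma (in prob_space) L2_fun_const: "(\<lambda>z. c) \<in> L2_fun M"
  by (simp add: L2_fun_def)

lemma (in prob_space) integrable_L2: "f \<in> L2_fun M \<Longrightarrow> integrable M f"
  using integrable_L2_mult[OF _ L2_fun_const[of 1], of f] by simp

lemma (in prob_space) L2_fun0_lincomb:
  assumes "f \<in> L2_fun0 M" "g \<in> L2_fun0 M" shows "(\<lambda>z. a * f z + b * g z) \<in> L2_fun0 M"
  using assms by (simp add: L2_fun0_def L2_fun_lincomb integrable_L2)

definition L2_ip :: "'a measure \<Rightarrow> ('a \<Rightarrow> real) \<Rightarrow> ('a \<Rightarrow> real) \<Rightarrow> real" where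
  "L2_ip M f g = (\<integral>z. f z * g z \<partial>M)"

lemma L2_fun_norm_ip: "L2_fun_norm M f = sqrt (L2_ip M f f)"
  by (simp add: L2_fun_norm_def L2_ip_def power2_eq_square)

lemma L2_ip_lincomb_left:
  assumes "f \<in> L2_fun M" "g \<in> L2_fun M" "h \<in> L2_fun M"
  shows "L2_ip M (\<lambda>z. a * f z + b * g z) h = a * L2_ip M f h + b * L2_ip M g h"
proof -
  have "L2_ip M (\<lambda>z. a * f z + b * g z) h = (\<integral>z. a * (f z * h z) + b * (g z * h z) \<partial>M)"
    by (simp add: L2_ip_def algebra_simps)
  also have "\<dots> = a * L2_ip M f h + b * L2_ip M g h"
    using assms by (simp add: L2_ip_def integrable_L2_mult)
  finally show ?thesis .
qed

definition kernel_integral :: "('a \<Rightarrow> 'a measure) \<Rightarrow> ('a \<Rightarrow> real) \<Rightarrow> 'a \<Rightarrow> real" where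
  "kernel_integral K f z = (\<integral>w. f w \<partial>K z)"

lemma (in prob_space) square_nn_integral_le:
  assumes f: "f \<in> borel_measurable M"
  shows "(\<integral>\<^sup>+z. ennreal \<bar>f z\<bar> \<partial>M)\<^sup>2 \<le> (\<integral>\<^sup>+z. ennreal ((f z)\<^sup>2) \<partial>M)"
  using Cauchy_Schwarz_nn_integral[of "\<lambda>z. ennreal \<bar>f z\<bar>" M "\<lambda>_. 1"] f emeasure_space_1
  by (simp add: ennreal_power)

locale invariant_kernel = prob_space M for M :: "'a measure" +
  fixes K :: "'a \<Rightarrow> 'a measure"
  assumes kernel: "K \<in> M \<rightarrow>\<^sub>M prob_algebra M" and invariant: "M \<bind> K = M"
begin

lemma kernel_subprob: "K \<in> M \<rightarrow>\<^sub>M subprob_algebra M"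
  by (rule measurable_prob_algebraD[OF kernel])

lemma sets_kernel_eq: "z \<in> space M \<Longrightarrow> sets (K z) = sets M"
  and prob_space_kernel: "z \<in> space M \<Longrightarrow> prob_space (K z)"
  using measurable_space[OF kernel] by (auto simp: space_prob_algebra)

lemma measurable_kernel_cong:
  "z \<in> space M \<Longrightarrow> f \<in> borel_measurable M \<Longrightarrow> f \<in> borel_measurable (K z)"
  using sets_kernel_eq by (simp cong: measurable_cong_sets)

lemma nn_integral_kernel:
  "f \<in> borel_measurable M \<Longrightarrow> (\<integral>\<^sup>+z. \<integral>\<^sup>+w. f w \<partial>K z \<partial>M) = (\<integral>\<^sup>+z. f z \<partial>M)"
  using nn_integral_bind[OF _ kernel_subprob, of f] by (simp add: invariant)

lemma kernel_finite:
  assumes "integrable M f"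
  shows "(\<integral>\<^sup>+z. \<integral>\<^sup>+w. ennreal \<bar>f w\<bar> \<partial>K z \<partial>M) < \<infinity>"
  using assms by (subst nn_integral_kernel) (auto simp: integrable_iff_bounded)

lemma AE_integrable:
  fixes f :: "'a \<Rightarrow> real"
  shows "integrable M f \<Longrightarrow> AE z in M. integrable (K z) f"
  using kernel_finite[of f] by (intro AE_integrable_kernel[OF kernel] not_empty) auto

lemma integral_kernel:
  fixes f :: "'a \<Rightarrow> real"
  shows "integrable M f \<Longrightarrow> (\<integral>z. \<integral>w. f w \<partial>K z \<partial>M) = (\<integral>z. f z \<partial>M)"
  using kernel_finite[of f] integral_bind_integrable[OF kernel _ not_empty, of f]
  by (simp add: invariant)

lemma kernel_integral_measurable:
  "f \<in> borel_measurable M \<Longrightarrow> kernel_integral K f \<in> borel_measurable M"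
  unfolding kernel_integral_def[abs_def]
  by (rule measurable_compose[OF kernel_subprob integral_measurable_subprob_algebra])

text \<open>Where \<open>f\<close> is not integrable against \<open>K z\<close>, the left-hand side is \<open>0\<close> by the convention for
  Bochner integrals, so the estimate holds at every point \<open>z\<close>.\<close>

lemma kernel_integral_square_le:
  assumes z: "z \<in> space M" and f: "f \<in> borel_measurable M"
  shows "ennreal ((kernel_integral K f z)\<^sup>2) \<le> (\<integral>\<^sup>+w. ennreal ((f w)\<^sup>2) \<partial>K z)"
proof -
  interpret Kz: prob_space "K z" using z by (rule prob_space_kernel)
  have "ennreal \<bar>kernel_integral K f z\<bar> \<le> (\<integral>\<^sup>+w. ennreal \<bar>f w\<bar> \<partial>K z)"
    unfolding kernel_integral_def
    using integral_norm_bound_ennreal[of "K z" f]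
    by (cases "integrable (K z) f") (auto simp: not_integrable_integral_eq)
  then have "(ennreal \<bar>kernel_integral K f z\<bar>)\<^sup>2 \<le> (\<integral>\<^sup>+w. ennreal \<bar>f w\<bar> \<partial>K z)\<^sup>2"
    by (rule power_mono) simp
  also have "\<dots> \<le> (\<integral>\<^sup>+w. ennreal ((f w)\<^sup>2) \<partial>K z)"
    by (rule Kz.square_nn_integral_le[OF measurable_kernel_cong[OF z f]])
  finally show ?thesis by (simp add: ennreal_power)
qed

lemma kernel_integral_L2:
  assumes f: "f \<in> L2_fun M" shows "kernel_integral K f \<in> L2_fun M"
proof -
  have "(\<integral>\<^sup>+z. ennreal ((kernel_integral K f z)\<^sup>2) \<partial>M) \<le> (\<integral>\<^sup>+z. \<integral>\<^sup>+w. ennreal ((f w)\<^sup>2) \<partial>K z \<partial>M)"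
    using f by (intro nn_integral_mono kernel_integral_square_le) (simp_all add: L2_funD)
  also have "\<dots> = (\<integral>\<^sup>+z. ennreal ((f z)\<^sup>2) \<partial>M)"
    using L2_funD(1)[OF f] by (intro nn_integral_kernel) measurable
  also have "\<dots> < \<infinity>" using L2_funD(2)[OF f] by (simp add: integrable_iff_bounded)
  finally show ?thesis
    using kernel_integral_measurable[of f] f
    by (auto simp: L2_fun_def integrable_iff_bounded)
qed

lemma kernel_integral_L20:
  assumes f: "f \<in> L2_fun0 M" shows "kernel_integral K f \<in> L2_fun0 M"
proof -
  have "f \<in> L2_fun M" "(\<integral>z. f z \<partial>M) = 0" using f by (simp_all add: L2_fun0_def)
  moreover from this have "(\<integral>z. kernel_integral K f z \<partial>M) = 0"
    unfolding kernel_integral_def by (simp add: integral_kernel integrable_L2)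
  ultimately show ?thesis by (simp add: L2_fun0_def kernel_integral_L2)
qed

text \<open>The identity can fail on a null set of \<open>z\<close>, where \<open>f\<close> is not integrable against the
  two-step kernel.\<close>

lemma kernel_integral_bind:
  assumes f: "integrable M f" and L: "invariant_kernel M L"
  shows "AE z in M. kernel_integral (\<lambda>z. K z \<bind> L) f z = kernel_integral K (kernel_integral L f) z"
proof -
  interpret L: invariant_kernel M L by fact
  have "(\<integral>\<^sup>+z. \<integral>\<^sup>+w. (\<integral>\<^sup>+v. ennreal \<bar>f v\<bar> \<partial>L w) \<partial>K z \<partial>M) < \<infinity>"
    using L.kernel_finite[OF f] f
    by (subst nn_integral_kernel)
       (auto intro!: measurable_compose[OF L.kernel_subprob nn_integral_measurable_subprob_algebra])
  then have "AE z in M. (\<integral>\<^sup>+w. (\<integral>\<^sup>+v. ennreal \<bar>f v\<bar> \<partial>L w) \<partial>K z) \<noteq> \<infinity>"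
    using f by (intro nn_integral_PInf_AE)
      (auto intro!: measurable_compose[OF kernel_subprob nn_integral_measurable_subprob_algebra]
         measurable_compose[OF L.kernel_subprob nn_integral_measurable_subprob_algebra])
  then show ?thesis
  proof (rule AE_mp, intro AE_I2 impI)
    fix z assume z: "z \<in> space M" and fin: "(\<integral>\<^sup>+w. (\<integral>\<^sup>+v. ennreal \<bar>f v\<bar> \<partial>L w) \<partial>K z) \<noteq> \<infinity>"
    interpret Kz: prob_space "K z" using z by (rule prob_space_kernel)
    have "L \<in> K z \<rightarrow>\<^sub>M prob_algebra M"
      using L.kernel sets_kernel_eq[OF z] by (simp cong: measurable_cong_sets)
    from integral_bind_integrable[OF this _ Kz.not_empty, of f] fin f
    show "kernel_integral (\<lambda>z. K z \<bind> L) f z = kernel_integral K (kernel_integral L f) z"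
      by (simp add: kernel_integral_def less_top)
  qed
qed

lemma invariant_kernel_bind:
  assumes L: "invariant_kernel M L" shows "invariant_kernel M (\<lambda>z. K z \<bind> L)"
proof -
  interpret L: invariant_kernel M L by fact
  show ?thesis
  proof unfold_locales
    show "(\<lambda>z. K z \<bind> L) \<in> M \<rightarrow>\<^sub>M prob_algebra M"
      by (rule measurable_bind_prob_space[OF kernel L.kernel])
    show "M \<bind> (\<lambda>z. K z \<bind> L) = M"
      using bind_assoc[OF kernel_subprob L.kernel_subprob] by (simp add: invariant L.invariant)
  qed
qed

lemma invariant_kernel_power: "invariant_kernel M (kernel_power M K n)"
proof (induction n)
  case 0
  show ?case by unfold_locales (simp_all add: bind_return'')
next
  case (Suc n)
  interpret P: invariant_kernel M "kernel_power M K n" by fact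
  show ?case using P.invariant_kernel_bind[OF invariant_kernel_axioms] by simp
qed

end

section \<open>The convergence rate in terms of the adjoint operator\<close>

lemma (in prob_space) semi_inner_space_L2: "semi_inner_space (L2_fun0 M) (L2_ip M)"
proof
  show "L2_ip M f g = L2_ip M g f" for f g by (simp add: L2_ip_def mult.commute)
  show "0 \<le> L2_ip M f f" for f by (simp add: L2_ip_def)
qed (rule L2_fun0_lincomb L2_ip_lincomb_left; simp add: L2_fun0_def)+

lemma (in prob_space) L2_prob_density:
  assumes \<mu>: "\<mu> \<in> L2_prob M"
  obtains h where "h \<in> L2_fun M" "\<And>z. 0 \<le> h z" "(\<integral>z. h z \<partial>M) = 1"
    "\<mu> = density M (\<lambda>z. ennreal (h z))"
proof
  let ?h = "\<lambda>z. enn2real (RN_deriv M \<mu> z)"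
  interpret \<mu>: prob_space \<mu> using \<mu> by (simp add: L2_prob_def)
  have ac: "absolutely_continuous M \<mu>" "sets \<mu> = sets M" using \<mu> by (simp_all add: L2_prob_def)
  show h: "?h \<in> L2_fun M" using \<mu> by (simp add: L2_prob_def)
  show "0 \<le> ?h z" for z by simp
  have "AE z in M. ennreal (?h z) = RN_deriv M \<mu> z"
    using RN_deriv_finite[OF _ ac] \<mu>.sigma_finite_measure_axioms
    by (auto simp: less_top)
  then have "density M (\<lambda>z. ennreal (?h z)) = density M (RN_deriv M \<mu>)"
    using h by (intro density_cong) (auto dest: L2_funD)
  also have "\<dots> = \<mu>" by (rule density_RN_deriv[OF ac])
  finally show eq: "\<mu> = density M (\<lambda>z. ennreal (?h z))" by simp
  have "(\<integral>\<^sup>+z. ennreal (?h z) \<partial>M) = emeasure (density M (\<lambda>z. ennreal (?h z))) (space M)"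
    using h by (subst emeasure_density) (auto dest: L2_funD intro!: nn_integral_cong)
  also have "\<dots> = 1"
    unfolding eq[symmetric] using \<mu>.emeasure_space_1 sets_eq_imp_space_eq[OF ac(2)] by simp
  finally show "(\<integral>z. ?h z \<partial>M) = 1"
    using h by (subst integral_eq_nn_integral) (auto dest: L2_funD)
qed

lemma (in prob_space) density_in_L2_prob:
  assumes h: "h \<in> L2_fun M" "\<And>z. 0 \<le> h z" "(\<integral>z. h z \<partial>M) = 1"
  shows "density M (\<lambda>z. ennreal (h z)) \<in> L2_prob M"
proof -
  let ?\<mu> = "density M (\<lambda>z. ennreal (h z))"
  have hm: "h \<in> borel_measurable M" by (rule L2_funD[OF h(1)])
  have "(\<integral>\<^sup>+z. ennreal (h z) \<partial>M) = 1"
    using h integrable_L2[OF h(1)] by (subst nn_integral_eq_integral) auto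
  moreover have "emeasure ?\<mu> (space ?\<mu>) = (\<integral>\<^sup>+z. ennreal (h z) \<partial>M)"
    using hm by (subst emeasure_density) (auto intro!: nn_integral_cong)
  ultimately have "emeasure ?\<mu> (space ?\<mu>) = 1" by simp
  then have "prob_space ?\<mu>" by (rule prob_spaceI)
  moreover have "absolutely_continuous M ?\<mu>"
    using hm by (intro absolutely_continuousI_density) measurable
  moreover have "AE z in M. ennreal (h z) = RN_deriv M ?\<mu> z"
    using hm by (intro RN_deriv_unique refl) measurable
  then have "AE z in M. (h z)\<^sup>2 = (enn2real (RN_deriv M ?\<mu> z))\<^sup>2"
    by eventually_elim (metis enn2real_ennreal h(2))
  then have "integrable M (\<lambda>z. (enn2real (RN_deriv M ?\<mu> z))\<^sup>2)"
    using L2_funD(2)[OF h(1)] hm by (subst integrable_cong_AE[symmetric, of "\<lambda>z. (h z)\<^sup>2"]) auto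
  ultimately show ?thesis by (simp add: L2_prob_def L2_fun_def)
qed

context invariant_kernel
begin

text \<open>Fubini's theorem applies because \<open>h \<bar>f\<bar> \<le> h\<^sup>2 + f\<^sup>2\<close> and invariance make the double integral
  finite.\<close>

lemma integral_density_bind:
  assumes h: "h \<in> L2_fun M" "\<And>z. 0 \<le> h z" and f: "f \<in> L2_fun M"
  shows "(\<integral>w. f w \<partial>(density M (\<lambda>z. ennreal (h z)) \<bind> K)) = L2_ip M h (kernel_integral K f)"
proof -
  let ?\<mu> = "density M (\<lambda>z. ennreal (h z))"
  have [measurable]: "h \<in> borel_measurable M" "f \<in> borel_measurable M"
    using h f by (auto dest: L2_funD)
  have [measurable]: "(\<lambda>z. \<integral>\<^sup>+w. g w \<partial>K z) \<in> borel_measurable M" if "g \<in> borel_measurable M" for g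
    using that by (rule measurable_compose[OF kernel_subprob nn_integral_measurable_subprob_algebra])
  have bound: "ennreal (h z) * (\<integral>\<^sup>+w. ennreal \<bar>f w\<bar> \<partial>K z)
      \<le> ennreal ((h z)\<^sup>2) + (\<integral>\<^sup>+w. ennreal ((f w)\<^sup>2) \<partial>K z)" if z: "z \<in> space M" for z
  proof -
    interpret Kz: prob_space "K z" using z by (rule prob_space_kernel)
    have [measurable]: "f \<in> borel_measurable (K z)" using z by (rule measurable_kernel_cong) simp
    have "ennreal (h z) * (\<integral>\<^sup>+w. ennreal \<bar>f w\<bar> \<partial>K z) = (\<integral>\<^sup>+w. ennreal (h z * \<bar>f w\<bar>) \<partial>K z)"
      using h by (simp add: nn_integral_cmult ennreal_mult)
    also have "\<dots> \<le> (\<integral>\<^sup>+w. ennreal ((h z)\<^sup>2) + ennreal ((f w)\<^sup>2) \<partial>K z)"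
      using abs_mult_le_sum_squares[of "h z"] h
      by (intro nn_integral_mono) (simp add: abs_mult ennreal_leI flip: ennreal_plus)
    also have "\<dots> = ennreal ((h z)\<^sup>2) + (\<integral>\<^sup>+w. ennreal ((f w)\<^sup>2) \<partial>K z)"
      by (simp add: nn_integral_add Kz.emeasure_space_1)
    finally show ?thesis .
  qed
  have "(\<integral>\<^sup>+z. \<integral>\<^sup>+w. ennreal \<bar>f w\<bar> \<partial>K z \<partial>?\<mu>)
      = (\<integral>\<^sup>+z. ennreal (h z) * (\<integral>\<^sup>+w. ennreal \<bar>f w\<bar> \<partial>K z) \<partial>M)"
    by (subst nn_integral_density) auto
  also have "\<dots> \<le> (\<integral>\<^sup>+z. ennreal ((h z)\<^sup>2) + (\<integral>\<^sup>+w. ennreal ((f w)\<^sup>2) \<partial>K z) \<partial>M)"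
    by (intro nn_integral_mono bound)
  also have "\<dots> = (\<integral>\<^sup>+z. ennreal ((h z)\<^sup>2) \<partial>M) + (\<integral>\<^sup>+z. ennreal ((f z)\<^sup>2) \<partial>M)"
    by (simp add: nn_integral_add nn_integral_kernel)
  also have "\<dots> < \<infinity>"
    using L2_funD(2)[OF h(1)] L2_funD(2)[OF f] by (simp add: integrable_iff_bounded)
  finally have "(\<integral>w. f w \<partial>(?\<mu> \<bind> K)) = (\<integral>z. kernel_integral K f z \<partial>?\<mu>)"
    unfolding kernel_integral_def
    using kernel by (intro integral_bind_integrable[where N = M]) (auto simp: not_empty)
  also have "\<dots> = L2_ip M h (kernel_integral K f)"
    unfolding L2_ip_def using h kernel_integral_measurable[of f]
    by (subst integral_real_density) auto
  finally show ?thesis .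
qed

definition L2_rates :: "real set" where
  "L2_rates = {\<rho> \<in> {0..1}. \<forall>\<mu>\<in>L2_prob M. \<exists>C. \<forall>n::nat. 1 \<le> n \<longrightarrow>
       L2_dist M (\<mu> \<bind> kernel_power M K n) M < ennreal (C * \<rho> ^ n)}"

lemma L2_rate_Inf: "L2_rate M K = Inf L2_rates"
  by (simp add: L2_rate_def L2_rates_def)

end

text \<open>The \<open>n\<close>-step kernel only enters through pairings \<open>\<langle>g, P\<^sup>n f\<rangle>\<close>, so an operator \<open>S\<close> with
  \<open>\<langle>S g, f\<rangle> = \<langle>g, P f\<rangle>\<close> carries all the information. For the Gibbs kernels it is explicit.\<close>

locale invariant_kernel_adjoint = invariant_kernel +
  fixes S :: "('a \<Rightarrow> real) \<Rightarrow> 'a \<Rightarrow> real"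
  assumes adjoint_in: "g \<in> L2_fun0 M \<Longrightarrow> S g \<in> L2_fun0 M"
    and adjoint: "g \<in> L2_fun0 M \<Longrightarrow> f \<in> L2_fun0 M
          \<Longrightarrow> L2_ip M (S g) f = L2_ip M g (kernel_integral K f)"
begin

interpretation L2: semi_inner_space "L2_fun0 M" "L2_ip M" by (rule semi_inner_space_L2)

lemma adjoint_power_in: "g \<in> L2_fun0 M \<Longrightarrow> (S ^^ n) g \<in> L2_fun0 M"
  by (induction n) (auto intro: adjoint_in)

lemma adjoint_power:
  assumes g: "g \<in> L2_fun0 M" and f: "f \<in> L2_fun0 M"
  shows "L2_ip M ((S ^^ n) g) f = L2_ip M g (kernel_integral (kernel_power M K n) f)"
  using f
proof (induction n arbitrary: f)
  case 0
  then have "f \<in> borel_measurable M" by (simp add: L2_fun0_def L2_fun_def)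
  then have "kernel_integral (return M) f z = f z" if "z \<in> space M" for z
    using that by (simp add: kernel_integral_def integral_return)
  then show ?case
    by (auto simp: L2_ip_def intro!: Bochner_Integration.integral_cong)
next
  case (Suc n)
  interpret P: invariant_kernel M "kernel_power M K n" by (rule invariant_kernel_power)
  interpret PK: invariant_kernel M "kernel_power M K (Suc n)" by (rule invariant_kernel_power)
  have fL: "f \<in> L2_fun M" "kernel_integral K f \<in> L2_fun0 M"
    using Suc.prems kernel_integral_L20[OF Suc.prems] by (simp_all add: L2_fun0_def)
  have "L2_ip M ((S ^^ Suc n) g) f = L2_ip M ((S ^^ n) g) (kernel_integral K f)"
    using Suc.prems g by (simp add: adjoint adjoint_power_in)
  also have "\<dots> = L2_ip M g (kernel_integral (kernel_power M K n) (kernel_integral K f))"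
    by (rule Suc.IH[OF fL(2)])
  also have "\<dots> = L2_ip M g (kernel_integral (kernel_power M K (Suc n)) f)"
    unfolding L2_ip_def
  proof (rule integral_cong_AE)
    have [measurable]: "g \<in> borel_measurable M" "f \<in> borel_measurable M"
      "kernel_integral K f \<in> borel_measurable M"
      using g fL by (auto simp: L2_fun0_def L2_fun_def)
    note P.kernel_integral_measurable[measurable] PK.kernel_integral_measurable[measurable]
    show "(\<lambda>z. g z * kernel_integral (kernel_power M K n) (kernel_integral K f) z)
        \<in> borel_measurable M" by measurable
    show "(\<lambda>z. g z * kernel_integral (kernel_power M K (Suc n)) f z) \<in> borel_measurable M"
      by measurable
    show "AE z in M. g z * kernel_integral (kernel_power M K n) (kernel_integral K f) z
        = g z * kernel_integral (kernel_power M K (Suc n)) f z"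
      using P.kernel_integral_bind[OF integrable_L2[OF fL(1)] invariant_kernel_axioms]
      by eventually_elim simp
  qed
  finally show ?case .
qed

text \<open>For mean-zero \<open>f\<close>, \<open>\<mu> P\<^sup>n f = \<langle>h, P\<^sup>n f\<rangle> = \<langle>h - 1, P\<^sup>n f\<rangle> = \<langle>S\<^sup>n (h - 1), f\<rangle>\<close>. If the norm of
  \<open>S\<^sup>n (h - 1)\<close> is not \<open>0\<close>, the supremum over the unit sphere is attained at its normalisation.\<close>

lemma L2_dist_density:
  assumes h: "h \<in> L2_fun M" "\<And>z. 0 \<le> h z" "(\<integral>z. h z \<partial>M) = 1"
  shows "L2_dist M (density M (\<lambda>z. ennreal (h z)) \<bind> kernel_power M K n) M
           = ennreal (L2_fun_norm M ((S ^^ n) (\<lambda>z. h z - 1)))"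
proof -
  interpret P: invariant_kernel M "kernel_power M K n" by (rule invariant_kernel_power)
  let ?\<mu> = "density M (\<lambda>z. ennreal (h z)) \<bind> kernel_power M K n"
  define w where "w = (S ^^ n) (\<lambda>z. h z - 1)"
  have h1: "(\<lambda>z. h z - 1) \<in> L2_fun0 M"
    using L2_fun_lincomb[OF h(1) L2_fun_const[of 1], of 1 "-1"] h integrable_L2[OF h(1)]
    by (simp add: L2_fun0_def prob_space)
  then have w: "w \<in> L2_fun0 M" by (simp add: w_def adjoint_power_in)
  have diff: "(\<integral>z. f z \<partial>?\<mu>) - (\<integral>z. f z \<partial>M) = L2_ip M w f" if f: "f \<in> L2_fun0 M" for f
  proof -
    let ?Pf = "kernel_integral (kernel_power M K n) f"
    have fL: "f \<in> L2_fun M" and f0: "(\<integral>z. f z \<partial>M) = 0" using f by (simp_all add: L2_fun0_def)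
    have Pf: "?Pf \<in> L2_fun M" "(\<integral>z. ?Pf z \<partial>M) = 0"
      using P.kernel_integral_L20[OF f] by (simp_all add: L2_fun0_def)
    have "(\<integral>z. f z \<partial>?\<mu>) = L2_ip M h ?Pf"
      by (rule P.integral_density_bind[OF h(1,2) fL])
    also have "\<dots> = (\<integral>z. h z * ?Pf z - ?Pf z \<partial>M)"
      using integrable_L2_mult[OF h(1) Pf(1)] integrable_L2[OF Pf(1)] Pf(2)
      by (simp add: L2_ip_def)
    also have "\<dots> = L2_ip M (\<lambda>z. h z - 1) ?Pf"
      by (simp add: L2_ip_def algebra_simps)
    also have "\<dots> = L2_ip M w f" unfolding w_def by (rule adjoint_power[OF h1 f, symmetric])
    finally show ?thesis using f0 by simp
  qed
  have "L2_dist M ?\<mu> M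
      = (SUP f \<in> {f \<in> L2_fun0 M. L2_fun_norm M f = 1}. ennreal \<bar>L2_ip M w f\<bar>)"
    unfolding L2_dist_def by (intro SUP_cong) (auto simp: diff)
  also have "\<dots> = ennreal (L2_fun_norm M w)"
  proof (rule antisym)
    show "(SUP f \<in> {f \<in> L2_fun0 M. L2_fun_norm M f = 1}. ennreal \<bar>L2_ip M w f\<bar>)
        \<le> ennreal (L2_fun_norm M w)"
    proof (rule SUP_least, rule ennreal_leI)
      fix f assume "f \<in> {f \<in> L2_fun0 M. L2_fun_norm M f = 1}"
      then have f: "f \<in> L2_fun0 M" "L2_ip M f f = 1" by (simp_all add: L2_fun_norm_ip)
      have "\<bar>L2_ip M w f\<bar> = sqrt ((L2_ip M w f)\<^sup>2)" by simp
      also have "\<dots> \<le> sqrt (L2_ip M w w * L2_ip M f f)"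
        by (intro real_sqrt_le_mono L2.Cauchy_Schwarz w f)
      finally show "\<bar>L2_ip M w f\<bar> \<le> L2_fun_norm M w" by (simp add: f L2_fun_norm_ip)
    qed
  next
    show "ennreal (L2_fun_norm M w)
        \<le> (SUP f \<in> {f \<in> L2_fun0 M. L2_fun_norm M f = 1}. ennreal \<bar>L2_ip M w f\<bar>)"
    proof (cases "L2_fun_norm M w = 0")
      case False
      define a where "a = L2_fun_norm M w"
      have a: "0 < a" "a\<^sup>2 = L2_ip M w w"
        using False L2.ip_nonneg[of w] by (simp_all add: a_def L2_fun_norm_ip less_le)
      \<comment> \<open>the summand \<open>0\<close> puts the scalar multiple in the form of a linear combination\<close>
      define f where "f = (\<lambda>z. (1 / a) * w z + 0 * w z)"
      have f: "f \<in> L2_fun0 M" unfolding f_def by (rule L2.lincomb_in[OF w w])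
      have "L2_ip M f f = 1"
        using a(1) unfolding f_def L2.ip_lincomb_self[OF w w] a(2)[symmetric]
        by (simp add: power_divide)
      moreover have "L2_ip M w f = a\<^sup>2 / a"
        unfolding f_def L2.ip_lincomb_right[OF w w w] by (simp add: a)
      then have "L2_ip M w f = a" using a(1) by (simp add: power2_eq_square)
      ultimately show ?thesis
        using f a by (intro SUP_upper2[of f]) (auto simp: L2_fun_norm_ip a_def)
    qed simp
  qed
  finally show ?thesis by (simp add: w_def)
qed

text \<open>\<open>S\<close> is linear only after pairing with test functions. Pairing \<open>S\<^sup>n (a u + b v)\<close> with itself
  suffices for the triangle inequality.\<close>

lemma adjoint_power_lincomb_norm:
  assumes u: "u \<in> L2_fun0 M" and v: "v \<in> L2_fun0 M"
  shows "L2_fun_norm M ((S ^^ n) (\<lambda>z. a * u z + b * v z))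
           \<le> \<bar>a\<bar> * L2_fun_norm M ((S ^^ n) u) + \<bar>b\<bar> * L2_fun_norm M ((S ^^ n) v)"
proof -
  interpret P: invariant_kernel M "kernel_power M K n" by (rule invariant_kernel_power)
  define w where "w = (S ^^ n) (\<lambda>z. a * u z + b * v z)"
  have uv: "(\<lambda>z. a * u z + b * v z) \<in> L2_fun0 M" by (rule L2.lincomb_in[OF u v])
  then have w: "w \<in> L2_fun0 M" by (simp add: w_def adjoint_power_in)
  have cs: "c * L2_ip M x w \<le> \<bar>c\<bar> * L2_fun_norm M x * L2_fun_norm M w"
    if "x \<in> L2_fun0 M" for c x
  proof -
    have "\<bar>L2_ip M x w\<bar> = sqrt ((L2_ip M x w)\<^sup>2)" by simp
    also have "\<dots> \<le> sqrt (L2_ip M x x * L2_ip M w w)"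
      by (intro real_sqrt_le_mono L2.Cauchy_Schwarz w that)
    finally have "\<bar>c\<bar> * \<bar>L2_ip M x w\<bar> \<le> \<bar>c\<bar> * (L2_fun_norm M x * L2_fun_norm M w)"
      by (intro mult_left_mono) (simp_all add: L2_fun_norm_ip real_sqrt_mult)
    moreover have "c * L2_ip M x w \<le> \<bar>c\<bar> * \<bar>L2_ip M x w\<bar>" by (simp flip: abs_mult)
    ultimately show ?thesis by (simp add: mult.assoc)
  qed
  have "(L2_fun_norm M w)\<^sup>2 = L2_ip M w w" by (simp add: L2_fun_norm_ip L2.ip_nonneg)
  also have "\<dots> = L2_ip M (\<lambda>z. a * u z + b * v z) (kernel_integral (kernel_power M K n) w)"
    using adjoint_power[OF uv w] by (simp add: w_def)
  also have "\<dots> = a * L2_ip M ((S ^^ n) u) w + b * L2_ip M ((S ^^ n) v) w"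
    using u v w by (simp add: L2.ip_lincomb_left P.kernel_integral_L20 adjoint_power)
  also have "\<dots> \<le> (\<bar>a\<bar> * L2_fun_norm M ((S ^^ n) u) + \<bar>b\<bar> * L2_fun_norm M ((S ^^ n) v))
      * L2_fun_norm M w"
    using cs[OF adjoint_power_in[OF u], of a n] cs[OF adjoint_power_in[OF v], of b n]
    by (simp add: distrib_right)
  finally have *: "(L2_fun_norm M w)\<^sup>2
      \<le> (\<bar>a\<bar> * L2_fun_norm M ((S ^^ n) u) + \<bar>b\<bar> * L2_fun_norm M ((S ^^ n) v)) * L2_fun_norm M w" .
  have nn: "0 \<le> L2_fun_norm M x" for x by (simp add: L2_fun_norm_ip L2.ip_nonneg)
  show ?thesis
  proof (cases "L2_fun_norm M w = 0")
    case True
    then show ?thesis using nn by (simp add: w_def)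
  next
    case False
    then have "0 < L2_fun_norm M w" using nn[of w] by simp
    from mult_right_le_imp_le[OF *[unfolded power2_eq_square] this] show ?thesis
      by (simp add: w_def)
  qed
qed

text \<open>A bound \<open>C \<rho>\<^sup>n\<close> becomes strict on replacing \<open>C\<close> by \<open>C + 1\<close>. This is where \<open>\<rho> > 0\<close> enters, since
  no distance is strictly below \<open>0\<close>.\<close>

lemma L2_ratesI:
  assumes bd: "\<And>g. g \<in> L2_fun0 M \<Longrightarrow> \<exists>C. \<forall>n\<ge>1. L2_fun_norm M ((S ^^ n) g) \<le> C * \<rho> ^ n"
    and \<rho>: "0 < \<rho>" "\<rho> \<le> 1"
  shows "\<rho> \<in> L2_rates"
  unfolding L2_rates_def
proof (intro CollectI conjI ballI)
  show "\<rho> \<in> {0..1}" using \<rho> by simp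
  fix \<mu> assume "\<mu> \<in> L2_prob M"
  then obtain h where h: "h \<in> L2_fun M" "\<And>z. 0 \<le> h z" "(\<integral>z. h z \<partial>M) = 1"
    and \<mu>: "\<mu> = density M (\<lambda>z. ennreal (h z))" using L2_prob_density by blast
  have "(\<lambda>z. h z - 1) \<in> L2_fun0 M"
    using L2_fun_lincomb[OF h(1) L2_fun_const[of 1], of 1 "-1"] h integrable_L2[OF h(1)]
    by (simp add: L2_fun0_def prob_space)
  with bd obtain C where C: "\<forall>n\<ge>1. L2_fun_norm M ((S ^^ n) (\<lambda>z. h z - 1)) \<le> C * \<rho> ^ n"
    by blast
  show "\<exists>C. \<forall>n\<ge>1. L2_dist M (\<mu> \<bind> kernel_power M K n) M < ennreal (C * \<rho> ^ n)"
  proof (intro exI allI impI)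
    fix n :: nat assume "1 \<le> n"
    have "L2_fun_norm M ((S ^^ n) (\<lambda>z. h z - 1)) \<le> C * \<rho> ^ n" using C \<open>1 \<le> n\<close> by blast
    also have "\<dots> < (C + 1) * \<rho> ^ n" using \<rho> by simp
    finally show "L2_dist M (\<mu> \<bind> kernel_power M K n) M < ennreal ((C + 1) * \<rho> ^ n)"
      unfolding \<mu> L2_dist_density[OF h]
      by (subst ennreal_less_iff) (simp_all add: L2_fun_norm_ip L2.ip_nonneg)
  qed
qed

text \<open>The positive and the negative part of \<open>g\<close> have the same integral \<open>m\<close>, so adding \<open>1\<close> to each and
  dividing by \<open>1 + m\<close> gives two probability densities, and \<open>g\<close> is \<open>1 + m\<close> times their
  difference. Adding \<open>1\<close> avoids a separate treatment of \<open>m = 0\<close>.\<close>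

lemma L2_ratesD:
  assumes \<rho>: "\<rho> \<in> L2_rates" and g: "g \<in> L2_fun0 M"
  shows "\<exists>C. \<forall>n\<ge>1. L2_fun_norm M ((S ^^ n) g) \<le> C * \<rho> ^ n"
proof -
  have gL: "g \<in> L2_fun M" and g0: "(\<integral>z. g z \<partial>M) = 0" using g by (simp_all add: L2_fun0_def)
  define m where "m = (\<integral>z. max 0 (g z) \<partial>M)"
  have parts: "(\<lambda>z. max 0 (s * g z)) \<in> L2_fun M" if "s\<^sup>2 = 1" for s :: real
  proof -
    have "integrable M (\<lambda>z. (max 0 (s * g z))\<^sup>2)"
    proof (rule Bochner_Integration.integrable_bound[OF L2_funD(2)[OF gL]])
      show "(\<lambda>z. (max 0 (s * g z))\<^sup>2) \<in> borel_measurable M"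
        using L2_funD(1)[OF gL] by measurable
      show "AE z in M. norm ((max 0 (s * g z))\<^sup>2) \<le> norm ((g z)\<^sup>2)"
        using that by (intro AE_I2) (simp add: max_def power_mult_distrib)
    qed
    then show ?thesis using L2_funD(1)[OF gL] by (simp add: L2_fun_def)
  qed
  have gp: "(\<lambda>z. max 0 (g z)) \<in> L2_fun M" and gm: "(\<lambda>z. max 0 (- g z)) \<in> L2_fun M"
    using parts[of 1] parts[of "-1"] by simp_all
  have m0: "0 \<le> m" unfolding m_def by (rule integral_nonneg_AE) simp
  have "(\<integral>z. max 0 (g z) - max 0 (- g z) \<partial>M) = (\<integral>z. g z \<partial>M)"
    by (intro Bochner_Integration.integral_cong) auto
  then have mm: "(\<integral>z. max 0 (- g z) \<partial>M) = m"
    using integrable_L2[OF gp] integrable_L2[OF gm] g0 by (simp add: m_def)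
  have dens: "\<exists>C. \<forall>n\<ge>1. L2_fun_norm M ((S ^^ n) (\<lambda>z. (1 + k z) / (1 + m) - 1)) \<le> C * \<rho> ^ n"
    and dens0: "(\<lambda>z. (1 + k z) / (1 + m) - 1) \<in> L2_fun0 M"
    if k: "k \<in> L2_fun M" "\<And>z. 0 \<le> k z" "(\<integral>z. k z \<partial>M) = m" for k
  proof -
    let ?h = "\<lambda>z. (1 + k z) / (1 + m)"
    have h: "?h \<in> L2_fun M"
      using L2_fun_lincomb[OF L2_fun_const[of 1] k(1), of "1 / (1 + m)" "1 / (1 + m)"]
      by (simp add: add_divide_distrib)
    have h1: "0 \<le> ?h z" for z using k m0 by simp
    have h2: "(\<integral>z. ?h z \<partial>M) = 1"
      using k m0 integrable_L2[OF k(1)] by (simp add: prob_space)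
    show "(\<lambda>z. (1 + k z) / (1 + m) - 1) \<in> L2_fun0 M"
      using L2_fun_lincomb[OF h L2_fun_const[of 1], of 1 "-1"] h2 integrable_L2[OF h]
      by (simp add: L2_fun0_def prob_space)
    have "density M (\<lambda>z. ennreal (?h z)) \<in> L2_prob M" by (rule density_in_L2_prob[OF h h1 h2])
    with \<rho> obtain C where C: "\<forall>n\<ge>1. L2_dist M (density M (\<lambda>z. ennreal (?h z))
        \<bind> kernel_power M K n) M < ennreal (C * \<rho> ^ n)"
      unfolding L2_rates_def by blast
    show "\<exists>C. \<forall>n\<ge>1. L2_fun_norm M ((S ^^ n) (\<lambda>z. (1 + k z) / (1 + m) - 1)) \<le> C * \<rho> ^ n"
    proof (intro exI allI impI)
      fix n :: nat assume "1 \<le> n"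
      with C have "ennreal (L2_fun_norm M ((S ^^ n) (\<lambda>z. ?h z - 1))) < ennreal (C * \<rho> ^ n)"
        unfolding L2_dist_density[OF h h1 h2, symmetric] by blast
      then show "L2_fun_norm M ((S ^^ n) (\<lambda>z. ?h z - 1)) \<le> C * \<rho> ^ n"
        by (simp add: ennreal_less_iff L2_fun_norm_ip L2.ip_nonneg)
    qed
  qed
  let ?u = "\<lambda>z. (1 + max 0 (g z)) / (1 + m) - 1" and ?v = "\<lambda>z. (1 + max 0 (- g z)) / (1 + m) - 1"
  have u: "?u \<in> L2_fun0 M" and v: "?v \<in> L2_fun0 M"
    using dens0[OF gp] dens0[OF gm] mm by (simp_all add: m_def)
  obtain C where C: "\<forall>n\<ge>1. L2_fun_norm M ((S ^^ n) ?u) \<le> C * \<rho> ^ n"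
    using dens[OF gp] by (auto simp: m_def)
  obtain D where D: "\<forall>n\<ge>1. L2_fun_norm M ((S ^^ n) ?v) \<le> D * \<rho> ^ n"
    using dens[OF gm] mm by auto
  have g_eq: "g = (\<lambda>z. (1 + m) * ?u z + (- (1 + m)) * ?v z)"
  proof
    fix z
    have "(1 + m) * ((1 + x) / (1 + m) - 1) = x - m" for x
      using m0 by (simp add: field_simps)
    from this[of "max 0 (g z)"] this[of "max 0 (- g z)"]
    have "(1 + m) * ?u z + (- (1 + m)) * ?v z = max 0 (g z) - max 0 (- g z)"
      by (simp only: mult_minus_left)
    then show "g z = (1 + m) * ?u z + (- (1 + m)) * ?v z" by simp
  qed
  show ?thesis
  proof (intro exI allI impI)
    fix n :: nat assume n: "1 \<le> n"
    have "L2_fun_norm M ((S ^^ n) g)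
        \<le> \<bar>1 + m\<bar> * L2_fun_norm M ((S ^^ n) ?u) + \<bar>- (1 + m)\<bar> * L2_fun_norm M ((S ^^ n) ?v)"
      using adjoint_power_lincomb_norm[OF u v, of n "1 + m" "- (1 + m)"]
      unfolding g_eq[symmetric] .
    also have "\<dots> \<le> (1 + m) * (C * \<rho> ^ n) + (1 + m) * (D * \<rho> ^ n)"
      using m0 n C D by (intro add_mono mult_mono) (auto simp: L2_fun_norm_ip L2.ip_nonneg)
    also have "\<dots> = ((1 + m) * (C + D)) * \<rho> ^ n" by (simp add: algebra_simps)
    finally show "L2_fun_norm M ((S ^^ n) g) \<le> ((1 + m) * (C + D)) * \<rho> ^ n" .
  qed
qed

end

section \<open>Conditional distributions as projections\<close>

text \<open>A kernel that averages over the fibres of some map. The condition asks for averages, as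
  functions, to be almost surely constant under each \<open>K z\<close>. A condition such as \<open>K w = K z\<close> for
  almost all \<open>w\<close> would be too strong, since fibres need not be measurable.\<close>

locale conditioning_kernel = invariant_kernel +
  assumes kernel_integral_const: "z \<in> space M \<Longrightarrow> f \<in> borel_measurable M
            \<Longrightarrow> AE w in K z. kernel_integral K f w = kernel_integral K f z"
begin

lemma kernel_integral_fixes:
  assumes z: "z \<in> space M" and f: "f \<in> borel_measurable M" and c: "AE w in K z. f w = f z"
  shows "kernel_integral K f z = f z"
proof -
  interpret Kz: prob_space "K z" using z by (rule prob_space_kernel)
  have "kernel_integral K f z = (\<integral>w. f z \<partial>K z)"
    unfolding kernel_integral_def
    using c measurable_kernel_cong[OF z f] by (intro integral_cong_AE) auto
  then show ?thesis by (simp add: Kz.prob_space)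
qed

text \<open>Let \<open>E f\<close> denote the kernel integral of \<open>f\<close>. By invariance the function \<open>(E f) g\<close> may first be
  averaged over \<open>K z\<close>, under which \<open>E f\<close> is almost surely constant and \<open>g\<close> has mean \<open>E g (z)\<close>. The
  right-hand side is symmetric in \<open>f\<close> and \<open>g\<close>, so the averaging operator is symmetric.\<close>

lemma L2_ip_kernel_integral:
  assumes f: "f \<in> L2_fun M" and g: "g \<in> L2_fun M"
  shows "L2_ip M (kernel_integral K f) g = L2_ip M (kernel_integral K f) (kernel_integral K g)"
proof -
  have m: "kernel_integral K f \<in> borel_measurable M" "g \<in> borel_measurable M"
    using f g by (auto intro: kernel_integral_measurable L2_funD)
  have "L2_ip M (kernel_integral K f) g = (\<integral>z. \<integral>w. kernel_integral K f w * g w \<partial>K z \<partial>M)"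
    unfolding L2_ip_def
    by (rule integral_kernel[OF integrable_L2_mult[OF kernel_integral_L2[OF f] g], symmetric])
  also have "\<dots> = (\<integral>z. kernel_integral K f z * kernel_integral K g z \<partial>M)"
  proof (rule Bochner_Integration.integral_cong[OF refl])
    fix z assume z: "z \<in> space M"
    have "(\<integral>w. kernel_integral K f w * g w \<partial>K z) = (\<integral>w. kernel_integral K f z * g w \<partial>K z)"
      using measurable_kernel_cong[OF z m(1)] measurable_kernel_cong[OF z m(2)]
        kernel_integral_const[OF z L2_funD(1)[OF f]]
      by (intro integral_cong_AE) auto
    then show "(\<integral>w. kernel_integral K f w * g w \<partial>K z)
        = kernel_integral K f z * kernel_integral K g z"
      by (simp add: kernel_integral_def)
  qed
  finally show ?thesis by (simp add: L2_ip_def)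
qed

lemma kernel_integral_idem:
  "f \<in> borel_measurable M \<Longrightarrow> z \<in> space M
    \<Longrightarrow> kernel_integral K (kernel_integral K f) z = kernel_integral K f z"
  by (intro kernel_integral_fixes kernel_integral_const kernel_integral_measurable)

lemma projection_kernel_integral:
  "semi_inner_space.projection (L2_fun0 M) (L2_ip M) (kernel_integral K)"
proof -
  interpret L2: semi_inner_space "L2_fun0 M" "L2_ip M" by (rule semi_inner_space_L2)
  show ?thesis
    unfolding L2.projection_def
  proof (intro conjI ballI)
    fix f g assume f: "f \<in> L2_fun0 M" and g: "g \<in> L2_fun0 M"
    then have fL: "f \<in> L2_fun M" and gL: "g \<in> L2_fun M" by (simp_all add: L2_fun0_def)
    show "L2_ip M (kernel_integral K f) g = L2_ip M f (kernel_integral K g)"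
      by (metis L2.ip_commute L2_ip_kernel_integral fL gL)
    show "L2_ip M (kernel_integral K (kernel_integral K f)) g = L2_ip M (kernel_integral K f) g"
      using kernel_integral_idem[OF L2_funD(1)[OF fL]]
      by (auto simp: L2_ip_def intro!: Bochner_Integration.integral_cong)
  qed (rule kernel_integral_L20)
qed

text \<open>The centred indicator of \<open>A\<close> is unchanged by the averaging and has variance \<open>m (1 - m)\<close> with
  \<open>m\<close> the measure of \<open>A\<close>. The set \<open>B\<close> serves to make \<open>m < 1\<close>.\<close>

lemma nontrivial_range:
  assumes A: "A \<in> sets M" and B: "B \<in> sets M" and disj: "A \<inter> B = {}"
    and pos: "0 < measure M A" "0 < measure M B"
    and c: "\<And>z. z \<in> space M \<Longrightarrow> AE w in K z. w \<in> A \<longleftrightarrow> z \<in> A"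
  shows "\<exists>f\<in>L2_fun0 M. 0 < L2_ip M (kernel_integral K f) (kernel_integral K f)"
proof
  define m where "m = measure M A"
  have "measure M A + measure M B \<le> 1"
    using finite_measure_Union[OF A B disj] prob_le_1[of "A \<union> B"] by simp
  then have m: "0 < m" "m < 1" using pos by (simp_all add: m_def)
  define f where "f z = indicator A z - m" for z
  have fm: "f \<in> borel_measurable M" using A unfolding f_def by measurable
  have sq: "(f z)\<^sup>2 = (1 - 2 * m) * indicator A z + m\<^sup>2" for z
    by (auto simp: f_def indicator_def power2_eq_square algebra_simps)
  have int: "integrable M (indicator A :: 'a \<Rightarrow> real)"
    using A by (simp add: emeasure_eq_measure)
  show f: "f \<in> L2_fun0 M"
  proof -
    have "integrable M (\<lambda>z. (f z)\<^sup>2)" using int by (simp add: sq)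
    moreover have "(\<integral>z. f z \<partial>M) = 0" using A int by (simp add: f_def m_def prob_space)
    ultimately show ?thesis using fm by (simp add: L2_fun0_def L2_fun_def)
  qed
  have fix_f: "kernel_integral K f z = f z" if z: "z \<in> space M" for z
    using c[OF z] by (intro kernel_integral_fixes[OF z fm]) (auto simp: f_def indicator_def)
  have "L2_ip M (kernel_integral K f) (kernel_integral K f) = (\<integral>z. (f z)\<^sup>2 \<partial>M)"
    unfolding L2_ip_def power2_eq_square
    by (intro Bochner_Integration.integral_cong) (simp_all add: fix_f)
  also have "\<dots> = (1 - 2 * m) * m + m\<^sup>2"
    using A int by (simp add: sq prob_space m_def)
  also have "\<dots> = m * (1 - m)" by (simp add: power2_eq_square algebra_simps)
  finally show "0 < L2_ip M (kernel_integral K f) (kernel_integral K f)" using m by simp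
qed

end

text \<open>Both sides agree on rectangles by the definition of a regular conditional distribution.\<close>

lemma regular_conditional_disintegration:
  assumes "prob_space \<Omega>" and rc: "regular_conditional \<Omega> M S N T \<kappa>"
    and S [measurable]: "S \<in> \<Omega> \<rightarrow>\<^sub>M M" and T [measurable]: "T \<in> \<Omega> \<rightarrow>\<^sub>M N"
  shows "distr \<Omega> (M \<Otimes>\<^sub>M N) (\<lambda>w. (S w, T w))
           = \<Omega> \<bind> (\<lambda>w. distr (\<kappa> (T w)) (M \<Otimes>\<^sub>M N) (\<lambda>s. (s, T w)))" (is "?L = ?R")
proof -
  interpret prob_space \<Omega> by fact
  have \<kappa> [measurable]: "\<kappa> \<in> N \<rightarrow>\<^sub>M prob_algebra M" using rc by (simp add: regular_conditional_def)
  have k [measurable]: "(\<lambda>w. distr (\<kappa> (T w)) (M \<Otimes>\<^sub>M N) (\<lambda>s. (s, T w))) \<in> \<Omega> \<rightarrow>\<^sub>M prob_algebra (M \<Otimes>\<^sub>M N)"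
    by (intro measurable_distr_prob_space2[where M = M]) measurable
  have \<Omega>: "\<Omega> \<in> space (prob_algebra \<Omega>)" using assms(1) by (simp add: space_prob_algebra)
  have R: "emeasure ?R (A \<times> B) = emeasure \<Omega> {w \<in> space \<Omega>. S w \<in> A \<and> T w \<in> B}"
    if A: "A \<in> sets M" and B: "B \<in> sets N" for A B
  proof -
    have "emeasure ?R (A \<times> B)
        = (\<integral>\<^sup>+w. emeasure (distr (\<kappa> (T w)) (M \<Otimes>\<^sub>M N) (\<lambda>s. (s, T w))) (A \<times> B) \<partial>\<Omega>)"
      using A B by (intro emeasure_bind_prob_algebra[OF \<Omega> k]) auto
    also have "\<dots> = (\<integral>\<^sup>+w. emeasure (\<kappa> (T w)) A * indicator B (T w) \<partial>\<Omega>)"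
    proof (rule nn_integral_cong)
      fix w assume w: "w \<in> space \<Omega>"
      then have t: "T w \<in> space N" using T by (rule measurable_space[rotated])
      have s [measurable_cong]: "sets (\<kappa> (T w)) = sets M"
        using measurable_space[OF \<kappa> t] by (simp add: space_prob_algebra)
      have "(\<lambda>s. (s, T w)) \<in> \<kappa> (T w) \<rightarrow>\<^sub>M M \<Otimes>\<^sub>M N" using t by measurable
      moreover have "(\<lambda>s. (s, T w)) -` (A \<times> B) \<inter> space (\<kappa> (T w)) = (if T w \<in> B then A else {})"
        using sets.sets_into_space[OF A] sets_eq_imp_space_eq[OF s] by auto
      ultimately show "emeasure (distr (\<kappa> (T w)) (M \<Otimes>\<^sub>M N) (\<lambda>s. (s, T w))) (A \<times> B)
          = emeasure (\<kappa> (T w)) A * indicator B (T w)"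
        using A B by (subst emeasure_distr) auto
    qed
    also have "\<dots> = (\<integral>\<^sup>+t\<in>B. emeasure (\<kappa> t) A \<partial>(distr \<Omega> N T))"
      using B measurable_emeasure_kernel[OF measurable_prob_algebraD[OF \<kappa>] A]
      by (subst nn_integral_distr[OF T]) simp_all
    also have "\<dots> = emeasure \<Omega> {w \<in> space \<Omega>. S w \<in> A \<and> T w \<in> B}"
      using rc A B by (simp add: regular_conditional_def)
    finally show ?thesis .
  qed
  have sR: "sets ?R = sets (M \<Otimes>\<^sub>M N)" by (rule sets_bind'[OF \<Omega> k])
  show ?thesis
  proof (rule measure_eqI_generator_eq[where E = "{a \<times> b | a b. a \<in> sets M \<and> b \<in> sets N}"
        and \<Omega> = "space M \<times> space N" and A = "\<lambda>_. space M \<times> space N"])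
    show "Int_stable {a \<times> b | a b. a \<in> sets M \<and> b \<in> sets N}" by (rule Int_stable_pair_measure_generator)
    show "{a \<times> b | a b. a \<in> sets M \<and> b \<in> sets N} \<subseteq> Pow (space M \<times> space N)"
      by (rule pair_measure_closed)
    show "emeasure ?L X = emeasure ?R X" if "X \<in> {a \<times> b | a b. a \<in> sets M \<and> b \<in> sets N}" for X
    proof -
      from that obtain A B where X: "X = A \<times> B" "A \<in> sets M" "B \<in> sets N" by auto
      have "emeasure ?L X = emeasure \<Omega> {w \<in> space \<Omega>. S w \<in> A \<and> T w \<in> B}"
        using X by (subst emeasure_distr) (auto intro!: arg_cong2[where f = emeasure])
      then show ?thesis using R X by simp
    qed
    show "sets ?L = sigma_sets (space M \<times> space N) {a \<times> b | a b. a \<in> sets M \<and> b \<in> sets N}"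
      by (simp add: sets_pair_measure)
    show "sets ?R = sigma_sets (space M \<times> space N) {a \<times> b | a b. a \<in> sets M \<and> b \<in> sets N}"
      by (simp add: sR sets_pair_measure)
    show "range (\<lambda>_. space M \<times> space N) \<subseteq> {a \<times> b | a b. a \<in> sets M \<and> b \<in> sets N}" by auto
    show "(\<Union>i::nat. space M \<times> space N) = space M \<times> space N" by simp
    show "emeasure ?L (space M \<times> space N) \<noteq> \<infinity>" for i :: nat
      by (subst emeasure_distr) (auto simp: emeasure_eq_measure)
  qed
qed

text \<open>The measure \<open>R\<close> is the mixture of \<open>P\<close> and \<open>Q\<close> along a Bernoulli variable, so the integral comes
  from Fubini's theorem for that kernel.\<close>

lemma integral_convex_combination:
  fixes f :: "'a \<Rightarrow> real"
  assumes r: "0 \<le> r" "r \<le> 1" and P: "P \<in> space (prob_algebra M)" and Q: "Q \<in> space (prob_algebra M)"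
    and sR: "sets R = sets M"
    and R: "\<And>A. A \<in> sets M \<Longrightarrow> emeasure R A = ennreal r * emeasure P A + ennreal (1 - r) * emeasure Q A"
    and f: "f \<in> borel_measurable M" "integrable P f" "integrable Q f"
  shows "(\<integral>w. f w \<partial>R) = r * (\<integral>w. f w \<partial>P) + (1 - r) * (\<integral>w. f w \<partial>Q)"
proof -
  define k where "k b = (if b then P else Q)" for b
  have k: "k \<in> measure_pmf (bernoulli_pmf r) \<rightarrow>\<^sub>M prob_algebra M"
    using P Q by (simp add: k_def)
  have b: "measure_pmf (bernoulli_pmf r) \<in> space (prob_algebra (measure_pmf (bernoulli_pmf r)))"
    by (simp add: space_prob_algebra prob_space_measure_pmf)
  have "R = measure_pmf (bernoulli_pmf r) \<bind> k"
  proof (rule measure_eqI)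
    show "sets R = sets (measure_pmf (bernoulli_pmf r) \<bind> k)"
      using sets_bind'[OF b k] sR by simp
    fix A assume "A \<in> sets R"
    then have A: "A \<in> sets M" using sR by simp
    show "emeasure R A = emeasure (measure_pmf (bernoulli_pmf r) \<bind> k) A"
      using r by (simp add: emeasure_bind_prob_algebra[OF b k A] R[OF A] k_def mult.commute)
  qed
  moreover have "(\<integral>\<^sup>+b. \<integral>\<^sup>+w. ennreal \<bar>f w\<bar> \<partial>k b \<partial>measure_pmf (bernoulli_pmf r)) < \<infinity>"
    using r f by (simp add: k_def integrable_iff_bounded ennreal_mult_less_top)
  ultimately have "(\<integral>w. f w \<partial>R) = (\<integral>b. \<integral>w. f w \<partial>k b \<partial>measure_pmf (bernoulli_pmf r))"
    using integral_bind_integrable[OF k f(1)] by simp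
  also have "\<dots> = r * (\<integral>w. f w \<partial>P) + (1 - r) * (\<integral>w. f w \<partial>Q)"
    using r by (simp add: k_def)
  finally show ?thesis .
qed

section \<open>The Gibbs kernels\<close>

locale gibbs_model =
  fixes MX :: "'x measure" and MY :: "'y measure" and J :: "('x \<times> 'y) measure"
    and KX :: "'y \<Rightarrow> 'x measure" and KY :: "'x \<Rightarrow> 'y measure"
  assumes prob_J: "prob_space J" and sets_J: "sets J = sets (MX \<Otimes>\<^sub>M MY)"
    and cond_X: "regular_conditional J MX fst MY snd KX"
    and cond_Y: "regular_conditional J MY snd MX fst KY"
begin

definition update_x :: "'x \<times> 'y \<Rightarrow> ('x \<times> 'y) measure" where
  "update_x z = distr (KX (snd z)) (MX \<Otimes>\<^sub>M MY) (\<lambda>x'. (x', snd z))"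

definition update_y :: "'x \<times> 'y \<Rightarrow> ('x \<times> 'y) measure" where
  "update_y z = distr (KY (fst z)) (MX \<Otimes>\<^sub>M MY) (\<lambda>y'. (fst z, y'))"

lemma KX_kernel [measurable]: "KX \<in> MY \<rightarrow>\<^sub>M prob_algebra MX"
  and KY_kernel [measurable]: "KY \<in> MX \<rightarrow>\<^sub>M prob_algebra MY"
  using cond_X cond_Y by (simp_all add: regular_conditional_def)

lemma space_J: "space J = space (MX \<Otimes>\<^sub>M MY)"
  by (rule sets_eq_imp_space_eq[OF sets_J])

lemma prob_algebra_J: "prob_algebra J = prob_algebra (MX \<Otimes>\<^sub>M MY)"
  by (simp add: prob_algebra_def subprob_algebra_cong[OF sets_J])

lemma measurable_J: "f \<in> J \<rightarrow>\<^sub>M N \<longleftrightarrow> f \<in> MX \<Otimes>\<^sub>M MY \<rightarrow>\<^sub>M N"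
  by (simp add: measurable_cong_sets[OF sets_J refl])

lemma update_x_kernel: "update_x \<in> J \<rightarrow>\<^sub>M prob_algebra J"
  unfolding prob_algebra_J measurable_J update_x_def[abs_def]
  by (intro measurable_distr_prob_space2[where M = MX]) measurable

lemma update_y_kernel: "update_y \<in> J \<rightarrow>\<^sub>M prob_algebra J"
  unfolding prob_algebra_J measurable_J update_y_def[abs_def]
  by (intro measurable_distr_prob_space2[where M = MY]) measurable

lemma sets_KX: "y \<in> space MY \<Longrightarrow> sets (KX y) = sets MX"
  and sets_KY: "x \<in> space MX \<Longrightarrow> sets (KY x) = sets MY"
  using measurable_space[OF KX_kernel] measurable_space[OF KY_kernel]
  by (simp_all add: space_prob_algebra)

lemma update_x_invariant: "J \<bind> update_x = J"
proof -
  have "J = distr J (MX \<Otimes>\<^sub>M MY) (\<lambda>z. (fst z, snd z))"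
    using distr_id2[of "MX \<Otimes>\<^sub>M MY" J] sets_J by simp
  also have "\<dots> = J \<bind> update_x"
    unfolding update_x_def[abs_def]
    by (rule regular_conditional_disintegration[OF prob_J cond_X]) (simp_all add: measurable_J)
  finally show ?thesis by simp
qed

text \<open>The disintegration produces pairs with the resampled coordinate first, so here it has to be
  composed with the swap of coordinates.\<close>

lemma update_y_invariant: "J \<bind> update_y = J"
proof -
  interpret prob_space J by (rule prob_J)
  let ?k = "\<lambda>z. distr (KY (fst z)) (MY \<Otimes>\<^sub>M MX) (\<lambda>y. (y, fst z))"
  have k: "?k \<in> J \<rightarrow>\<^sub>M prob_algebra (MY \<Otimes>\<^sub>M MX)"
    unfolding measurable_J by (intro measurable_distr_prob_space2[where M = MY]) measurable
  have swap: "(\<lambda>(y, x). (x, y)) \<in> MY \<Otimes>\<^sub>M MX \<rightarrow>\<^sub>M MX \<Otimes>\<^sub>M MY" by measurable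
  have "J = distr J (MX \<Otimes>\<^sub>M MY) (\<lambda>z. (fst z, snd z))"
    using distr_id2[of "MX \<Otimes>\<^sub>M MY" J] sets_J by simp
  also have "\<dots> = distr (distr J (MY \<Otimes>\<^sub>M MX) (\<lambda>z. (snd z, fst z))) (MX \<Otimes>\<^sub>M MY) (\<lambda>(y, x). (x, y))"
    by (subst distr_distr[OF swap]) (simp_all add: measurable_J comp_def)
  also have "\<dots> = distr (J \<bind> ?k) (MX \<Otimes>\<^sub>M MY) (\<lambda>(y, x). (x, y))"
    by (subst regular_conditional_disintegration[OF prob_J cond_Y]) (simp_all add: measurable_J)
  also have "\<dots> = J \<bind> (\<lambda>z. distr (?k z) (MX \<Otimes>\<^sub>M MY) (\<lambda>(y, x). (x, y)))"
    by (rule distr_bind[OF measurable_prob_algebraD[OF k] not_empty swap])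
  also have "\<dots> = J \<bind> update_y"
  proof (rule bind_cong[OF refl])
    fix z assume "z \<in> space J"
    then have x: "fst z \<in> space MX" by (auto simp: space_J space_pair_measure)
    note sets_KY[OF x, measurable_cong]
    have "(\<lambda>y. (y, fst z)) \<in> KY (fst z) \<rightarrow>\<^sub>M MY \<Otimes>\<^sub>M MX" using x by measurable
    then show "distr (?k z) (MX \<Otimes>\<^sub>M MY) (\<lambda>(y, x). (x, y)) = update_y z"
      by (simp add: distr_distr[OF swap] update_y_def comp_def)
  qed
  finally show ?thesis by simp
qed

text \<open>Measurability of \<open>P\<close> matters: the fibre \<open>snd w = snd z\<close> itself need not be measurable, and the
  complement of a nonmeasurable fibre need not be contained in a null set.\<close>

lemma AE_update_x:
  assumes z: "z \<in> space J" and P: "Measurable.pred J P"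
    and PI: "\<And>x. x \<in> space MX \<Longrightarrow> P (x, snd z)"
  shows "AE w in update_x z. P w"
proof -
  have y: "snd z \<in> space MY" using z by (auto simp: space_J space_pair_measure)
  note sets_KX[OF y, measurable_cong]
  have "(\<lambda>x'. (x', snd z)) \<in> KX (snd z) \<rightarrow>\<^sub>M MX \<Otimes>\<^sub>M MY" using y by measurable
  moreover have "{w \<in> space (MX \<Otimes>\<^sub>M MY). P w} \<in> sets (MX \<Otimes>\<^sub>M MY)"
    using P by (simp add: pred_def space_J sets_J)
  ultimately show ?thesis
    unfolding update_x_def using PI sets_eq_imp_space_eq[OF sets_KX[OF y]]
    by (subst AE_distr_iff) auto
qed

lemma AE_update_y:
  assumes z: "z \<in> space J" and P: "Measurable.pred J P"
    and PI: "\<And>y. y \<in> space MY \<Longrightarrow> P (fst z, y)"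
  shows "AE w in update_y z. P w"
proof -
  have x: "fst z \<in> space MX" using z by (auto simp: space_J space_pair_measure)
  note sets_KY[OF x, measurable_cong]
  have "(\<lambda>y'. (fst z, y')) \<in> KY (fst z) \<rightarrow>\<^sub>M MX \<Otimes>\<^sub>M MY" using x by measurable
  moreover have "{w \<in> space (MX \<Otimes>\<^sub>M MY). P w} \<in> sets (MX \<Otimes>\<^sub>M MY)"
    using P by (simp add: pred_def space_J sets_J)
  ultimately show ?thesis
    unfolding update_y_def using PI sets_eq_imp_space_eq[OF sets_KY[OF x]]
    by (subst AE_distr_iff) auto
qed

sublocale prob_space J by (rule prob_J)

sublocale X: conditioning_kernel J update_x
proof -
  interpret invariant_kernel J update_x
    by unfold_locales (rule update_x_kernel, rule update_x_invariant)
  show "conditioning_kernel J update_x"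
  proof
    fix z and f :: "'x \<times> 'y \<Rightarrow> real" assume z: "z \<in> space J" and f: "f \<in> borel_measurable J"
    note kernel_integral_measurable[OF f, measurable]
    show "AE w in update_x z. kernel_integral update_x f w = kernel_integral update_x f z"
      by (rule AE_update_x[OF z]) (measurable, simp add: kernel_integral_def update_x_def)
  qed
qed

sublocale Y: conditioning_kernel J update_y
proof -
  interpret invariant_kernel J update_y
    by unfold_locales (rule update_y_kernel, rule update_y_invariant)
  show "conditioning_kernel J update_y"
  proof
    fix z and f :: "'x \<times> 'y \<Rightarrow> real" assume z: "z \<in> space J" and f: "f \<in> borel_measurable J"
    note kernel_integral_measurable[OF f, measurable]
    show "AE w in update_y z. kernel_integral update_y f w = kernel_integral update_y f z"
      by (rule AE_update_y[OF z]) (measurable, simp add: kernel_integral_def update_y_def)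
  qed
qed

abbreviation "avg_x \<equiv> kernel_integral update_x"
abbreviation "avg_y \<equiv> kernel_integral update_y"

sublocale proj: two_projections "L2_fun0 J" "L2_ip J" avg_x avg_y
proof -
  interpret semi_inner_space "L2_fun0 J" "L2_ip J" by (rule semi_inner_space_L2)
  show "two_projections (L2_fun0 J) (L2_ip J) avg_x avg_y"
    by unfold_locales (rule X.projection_kernel_integral, rule Y.projection_kernel_integral)
qed

lemma det_scan_gibbs_eq:
  assumes z: "z \<in> space J"
  shows "det_scan_gibbs MX MY KX KY z = update_y z \<bind> update_x"
proof -
  have x: "fst z \<in> space MX" using z by (auto simp: space_J space_pair_measure)
  note sets_KY[OF x, measurable_cong]
  have m: "(\<lambda>y'. (fst z, y')) \<in> KY (fst z) \<rightarrow>\<^sub>M MX \<Otimes>\<^sub>M MY" using x by measurable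
  interpret KY: prob_space "KY (fst z)"
    using measurable_space[OF KY_kernel x] by (simp add: space_prob_algebra)
  have "update_x \<in> MX \<Otimes>\<^sub>M MY \<rightarrow>\<^sub>M subprob_algebra (MX \<Otimes>\<^sub>M MY)"
    using measurable_prob_algebraD[OF update_x_kernel]
    by (simp add: measurable_J subprob_algebra_cong[OF sets_J])
  then have "update_y z \<bind> update_x = KY (fst z) \<bind> (\<lambda>y. update_x (fst z, y))"
    unfolding update_y_def[of z] by (rule bind_distr[OF m _ KY.not_empty])
  then show ?thesis by (simp add: det_scan_gibbs_def update_x_def)
qed

lemma det_scan_invariant: "invariant_kernel J (det_scan_gibbs MX MY KX KY)"
proof unfold_locales
  interpret D: invariant_kernel J "\<lambda>z. update_y z \<bind> update_x"
    by (rule Y.invariant_kernel_bind[OF X.invariant_kernel_axioms])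
  show "det_scan_gibbs MX MY KX KY \<in> J \<rightarrow>\<^sub>M prob_algebra J"
    using D.kernel by (rule measurable_cong[THEN iffD1, rotated]) (simp add: det_scan_gibbs_eq)
  show "J \<bind> det_scan_gibbs MX MY KX KY = J"
    using D.invariant by (simp add: det_scan_gibbs_eq cong: bind_cong_simp)
qed

sublocale DG: invariant_kernel_adjoint J "det_scan_gibbs MX MY KX KY" "avg_x \<circ> avg_y"
proof -
  interpret D: invariant_kernel J "det_scan_gibbs MX MY KX KY" by (rule det_scan_invariant)
  show "invariant_kernel_adjoint J (det_scan_gibbs MX MY KX KY) (avg_x \<circ> avg_y)"
  proof
    fix g assume g: "g \<in> L2_fun0 J"
    then show "(avg_x \<circ> avg_y) g \<in> L2_fun0 J" by (simp add: proj.p_in proj.q_in)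
    fix f assume f: "f \<in> L2_fun0 J"
    then have fL: "f \<in> L2_fun J" by (simp add: L2_fun0_def)
    have "L2_ip J ((avg_x \<circ> avg_y) g) f = L2_ip J g (avg_y (avg_x f))"
      using f g by (simp add: proj.p_adj proj.q_adj proj.p_in proj.q_in)
    also have "\<dots> = L2_ip J g (kernel_integral (det_scan_gibbs MX MY KX KY) f)"
      unfolding L2_ip_def
    proof (rule integral_cong_AE)
      have [measurable]: "g \<in> borel_measurable J" "f \<in> borel_measurable J"
        using f g by (auto simp: L2_fun0_def L2_fun_def)
      note X.kernel_integral_measurable[measurable] Y.kernel_integral_measurable[measurable]
        D.kernel_integral_measurable[measurable]
      show "(\<lambda>z. g z * avg_y (avg_x f) z) \<in> borel_measurable J" by measurable
      show "(\<lambda>z. g z * kernel_integral (det_scan_gibbs MX MY KX KY) f z) \<in> borel_measurable J"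
        by measurable
      have "AE z in J. kernel_integral (\<lambda>z. update_y z \<bind> update_x) f z = avg_y (avg_x f) z"
        by (rule Y.kernel_integral_bind[OF integrable_L2[OF fL] X.invariant_kernel_axioms])
      then show "AE z in J. g z * avg_y (avg_x f) z
          = g z * kernel_integral (det_scan_gibbs MX MY KX KY) f z"
        by (rule AE_mp[OF _ AE_I2]) (simp add: kernel_integral_def det_scan_gibbs_eq)
    qed
    finally show "L2_ip J ((avg_x \<circ> avg_y) g) f
        = L2_ip J g (kernel_integral (det_scan_gibbs MX MY KX KY) f)" .
  qed
qed

lemma emeasure_rand_scan_updates:
  assumes z: "z \<in> space J" and A: "A \<in> sets J"
  shows "emeasure (rand_scan_gibbs r MX MY KX KY z) A
           = ennreal r * emeasure (update_x z) A + ennreal (1 - r) * emeasure (update_y z) A"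
proof -
  have xy: "fst z \<in> space MX" "snd z \<in> space MY"
    using z by (auto simp: space_J space_pair_measure)
  note sets_KX[OF xy(2), measurable_cong] sets_KY[OF xy(1), measurable_cong]
  have m: "(\<lambda>x'. (x', snd z)) \<in> KX (snd z) \<rightarrow>\<^sub>M MX \<Otimes>\<^sub>M MY"
    "(\<lambda>y'. (fst z, y')) \<in> KY (fst z) \<rightarrow>\<^sub>M MX \<Otimes>\<^sub>M MY" using xy by measurable
  have A': "A \<in> sets (MX \<Otimes>\<^sub>M MY)" using A sets_J by simp
  show ?thesis
    using z A' nn_integral_distr[OF m(1), of "indicator A"] nn_integral_distr[OF m(2), of "indicator A"]
    by (simp add: emeasure_rand_scan_gibbs[OF KX_kernel KY_kernel _ A'] space_J
        update_x_def update_y_def)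
qed

lemma rand_scan_invariant:
  assumes r: "0 \<le> r" "r \<le> 1" shows "invariant_kernel J (rand_scan_gibbs r MX MY KX KY)"
proof unfold_locales
  show R: "rand_scan_gibbs r MX MY KX KY \<in> J \<rightarrow>\<^sub>M prob_algebra J"
    unfolding prob_algebra_J measurable_J
    by (rule measurable_rand_scan_gibbs[OF KX_kernel KY_kernel r])
  have J: "J \<in> space (prob_algebra J)" using prob_J by (simp add: space_prob_algebra)
  show "J \<bind> rand_scan_gibbs r MX MY KX KY = J"
  proof (rule measure_eqI)
    show sb: "sets (J \<bind> rand_scan_gibbs r MX MY KX KY) = sets J" by (rule sets_bind'[OF J R])
    fix A assume "A \<in> sets (J \<bind> rand_scan_gibbs r MX MY KX KY)"
    then have A: "A \<in> sets J" using sb by simp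
    have "emeasure (J \<bind> rand_scan_gibbs r MX MY KX KY) A
        = (\<integral>\<^sup>+z. ennreal r * emeasure (update_x z) A + ennreal (1 - r) * emeasure (update_y z) A \<partial>J)"
      unfolding emeasure_bind_prob_algebra[OF J R A]
      by (intro nn_integral_cong emeasure_rand_scan_updates A)
    also have "\<dots> = ennreal r * emeasure (J \<bind> update_x) A + ennreal (1 - r) * emeasure (J \<bind> update_y) A"
      using A measurable_emeasure_kernel[OF X.kernel_subprob A] measurable_emeasure_kernel[OF Y.kernel_subprob A]
      by (simp add: nn_integral_add nn_integral_cmult
          emeasure_bind_prob_algebra[OF J update_x_kernel A]
          emeasure_bind_prob_algebra[OF J update_y_kernel A])
    also have "\<dots> = (ennreal r + ennreal (1 - r)) * emeasure J A"
      by (simp add: X.invariant Y.invariant distrib_right)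
    also have "\<dots> = emeasure J A" using r by (simp flip: ennreal_plus)
    finally show "emeasure (J \<bind> rand_scan_gibbs r MX MY KX KY) A = emeasure J A" .
  qed
qed

lemma rand_scan_adjoint:
  assumes r: "0 \<le> r" "r \<le> 1"
  shows "invariant_kernel_adjoint J (rand_scan_gibbs r MX MY KX KY) (proj.mixture r)"
proof -
  interpret R: invariant_kernel J "rand_scan_gibbs r MX MY KX KY"
    by (rule rand_scan_invariant[OF r])
  show ?thesis
  proof
    fix g assume g: "g \<in> L2_fun0 J"
    then show "proj.mixture r g \<in> L2_fun0 J" by (rule proj.mixture_in)
    fix f assume f: "f \<in> L2_fun0 J"
    then have fi: "integrable J f" by (simp add: L2_fun0_def integrable_L2)
    have "L2_ip J (proj.mixture r g) f = L2_ip J g (proj.mixture r f)"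
      by (rule proj.mixture_adj[OF g f])
    also have "\<dots> = L2_ip J g (kernel_integral (rand_scan_gibbs r MX MY KX KY) f)"
      unfolding L2_ip_def
    proof (rule integral_cong_AE)
      have [measurable]: "g \<in> borel_measurable J" "f \<in> borel_measurable J"
        "proj.mixture r f \<in> borel_measurable J"
        using f g proj.mixture_in[OF f, of r] by (auto simp: L2_fun0_def L2_fun_def)
      note R.kernel_integral_measurable[measurable]
      show "(\<lambda>z. g z * proj.mixture r f z) \<in> borel_measurable J" by measurable
      show "(\<lambda>z. g z * kernel_integral (rand_scan_gibbs r MX MY KX KY) f z) \<in> borel_measurable J"
        by measurable
      show "AE z in J. g z * proj.mixture r f z
          = g z * kernel_integral (rand_scan_gibbs r MX MY KX KY) f z"
        using X.AE_integrable[OF fi] Y.AE_integrable[OF fi] AE_space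
      proof eventually_elim
        case (elim z)
        have "(\<integral>w. f w \<partial>rand_scan_gibbs r MX MY KX KY z)
            = r * (\<integral>w. f w \<partial>update_x z) + (1 - r) * (\<integral>w. f w \<partial>update_y z)"
          using elim r by (intro integral_convex_combination[where M = J]
              emeasure_rand_scan_updates R.sets_kernel_eq measurable_space[OF update_x_kernel]
              measurable_space[OF update_y_kernel]) simp_all
        then show ?case by (simp add: kernel_integral_def proj.mixture_def)
      qed
    qed
    finally show "L2_ip J (proj.mixture r g) f
        = L2_ip J g (kernel_integral (rand_scan_gibbs r MX MY KX KY) f)" .
  qed
qed

lemma nontrivial_avg_y:
  assumes "A \<in> sets MX" "B \<in> sets MX" "A \<inter> B = {}"
    "0 < measure (distr J MX fst) A" "0 < measure (distr J MX fst) B"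
  shows "\<exists>f\<in>L2_fun0 J. 0 < L2_ip J (avg_y f) (avg_y f)"
proof (rule Y.nontrivial_range)
  have fst [measurable]: "fst \<in> J \<rightarrow>\<^sub>M MX" by (simp add: measurable_J)
  show "fst -` A \<inter> space J \<in> sets J" "fst -` B \<inter> space J \<in> sets J"
    using assms by (auto intro: measurable_sets[OF fst])
  show "(fst -` A \<inter> space J) \<inter> (fst -` B \<inter> space J) = {}" using assms by auto
  show "0 < measure J (fst -` A \<inter> space J)" "0 < measure J (fst -` B \<inter> space J)"
    using assms by (simp_all add: measure_distr)
  show "AE w in update_y z. (w \<in> fst -` A \<inter> space J) \<longleftrightarrow> (z \<in> fst -` A \<inter> space J)"
    if z: "z \<in> space J" for z
  proof (rule AE_update_y[OF z])
    show "Measurable.pred J (\<lambda>w. (w \<in> fst -` A \<inter> space J) \<longleftrightarrow> (z \<in> fst -` A \<inter> space J))"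
      using measurable_sets[OF fst assms(1)] by measurable
    show "((fst z, y) \<in> fst -` A \<inter> space J) \<longleftrightarrow> (z \<in> fst -` A \<inter> space J)"
      if "y \<in> space MY" for y
      using z that by (auto simp: space_J space_pair_measure)
  qed
qed

lemma nontrivial_avg_x:
  assumes "A \<in> sets MY" "B \<in> sets MY" "A \<inter> B = {}"
    "0 < measure (distr J MY snd) A" "0 < measure (distr J MY snd) B"
  shows "\<exists>f\<in>L2_fun0 J. 0 < L2_ip J (avg_x f) (avg_x f)"
proof (rule X.nontrivial_range)
  have snd [measurable]: "snd \<in> J \<rightarrow>\<^sub>M MY" by (simp add: measurable_J)
  show "snd -` A \<inter> space J \<in> sets J" "snd -` B \<inter> space J \<in> sets J"
    using assms by (auto intro: measurable_sets[OF snd])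
  show "(snd -` A \<inter> space J) \<inter> (snd -` B \<inter> space J) = {}" using assms by auto
  show "0 < measure J (snd -` A \<inter> space J)" "0 < measure J (snd -` B \<inter> space J)"
    using assms by (simp_all add: measure_distr)
  show "AE w in update_x z. (w \<in> snd -` A \<inter> space J) \<longleftrightarrow> (z \<in> snd -` A \<inter> space J)"
    if z: "z \<in> space J" for z
  proof (rule AE_update_x[OF z])
    show "Measurable.pred J (\<lambda>w. (w \<in> snd -` A \<inter> space J) \<longleftrightarrow> (z \<in> snd -` A \<inter> space J))"
      using measurable_sets[OF snd assms(1)] by measurable
    show "((x, snd z) \<in> snd -` A \<inter> space J) \<longleftrightarrow> (z \<in> snd -` A \<inter> space J)"
      if "x \<in> space MX" for x
      using z that by (auto simp: space_J space_pair_measure)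
  qed
qed

lemma det_scan_ratesI:
  assumes "proj.correlation_bound c" "0 < c" "c \<le> 1" shows "c \<in> DG.L2_rates"
proof (rule DG.L2_ratesI)
  show "\<exists>C. \<forall>n\<ge>1. L2_fun_norm J (((avg_x \<circ> avg_y) ^^ n) g) \<le> C * c ^ n" if "g \<in> L2_fun0 J" for g
    using proj.alternating_orbit_bound[OF assms(1,2) that] unfolding L2_fun_norm_ip by blast
qed (use assms in auto)

lemma det_scan_ratesD:
  assumes "c \<in> DG.L2_rates" shows "proj.correlation_bound c" "0 \<le> c" "c \<le> 1"
proof -
  show c: "0 \<le> c" "c \<le> 1" using assms by (auto simp: DG.L2_rates_def)
  show "proj.correlation_bound c"
    using DG.L2_ratesD[OF assms] c
    by (intro proj.correlation_bound_of_alternating_orbit_bound) (auto simp: L2_fun_norm_ip)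
qed

text \<open>The correlation bound is a closed condition on \<open>c\<close>, so it survives passing to the infimum.\<close>

lemma correlation_bound_det_scan_rate:
  "proj.correlation_bound (L2_rate J (det_scan_gibbs MX MY KX KY))"
  and det_scan_rate_unit_interval: "L2_rate J (det_scan_gibbs MX MY KX KY) \<in> {0..1}"
  and det_scan_rate_le: "c \<in> DG.L2_rates \<Longrightarrow> L2_rate J (det_scan_gibbs MX MY KX KY) \<le> c"
proof -
  let ?\<delta> = "L2_rate J (det_scan_gibbs MX MY KX KY)"
  have one: "1 \<in> DG.L2_rates"
    by (rule det_scan_ratesI[OF proj.correlation_bound_1]) simp_all
  have bdd: "bdd_below DG.L2_rates"
    by (rule bdd_belowI[of _ 0]) (rule det_scan_ratesD)
  show le: "?\<delta> \<le> c" if "c \<in> DG.L2_rates" for c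
    unfolding DG.L2_rate_Inf by (rule cInf_lower[OF that bdd])
  have ge: "x \<le> ?\<delta>" if "\<And>c. c \<in> DG.L2_rates \<Longrightarrow> x \<le> c" for x
    unfolding DG.L2_rate_Inf using one that by (intro cInf_greatest) auto
  show "?\<delta> \<in> {0..1}" using le[OF one] ge[of 0] det_scan_ratesD(2) by auto
  show "proj.correlation_bound ?\<delta>"
    unfolding proj.correlation_bound_def
  proof (intro ballI)
    fix f g assume fg: "f \<in> L2_fun0 J" "g \<in> L2_fun0 J"
    define X where "X = L2_ip J f f * L2_ip J g g"
    define e where "e = (L2_ip J (avg_x f) (avg_y g))\<^sup>2"
    have X: "0 \<le> X" by (simp add: X_def proj.ip_nonneg)
    have e: "e \<le> c * X" if "c \<in> DG.L2_rates" for c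
      using det_scan_ratesD(1)[OF that] fg by (simp add: proj.correlation_bound_def X_def e_def)
    show "(L2_ip J (avg_x f) (avg_y g))\<^sup>2 \<le> ?\<delta> * (L2_ip J f f * L2_ip J g g)"
    proof (cases "X = 0")
      case True
      then show ?thesis using e[OF one] unfolding X_def[symmetric] e_def[symmetric] by simp
    next
      case False
      then have "e / X \<le> ?\<delta>" using e X by (intro ge) (simp add: divide_le_eq)
      then have "e \<le> ?\<delta> * X" using False X by (simp add: pos_divide_le_eq)
      then show ?thesis by (simp add: X_def e_def)
    qed
  qed
qed

end

theorem theorem4p1:
  fixes MX :: "'x measure" and MY :: "'y measure"
    and J :: "('x \<times> 'y) measure"
    and KX :: "'y \<Rightarrow> 'x measure" and KY :: "'x \<Rightarrow> 'y measure"
    and r :: real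
  assumes "prob_space J" and "sets J = sets (MX \<Otimes>\<^sub>M MY)"
    and "regular_conditional J MX fst MY snd KX"
    and "regular_conditional J MY snd MX fst KY"
    and "\<exists>A1\<in>sets MX. \<exists>A2\<in>sets MX. A1 \<inter> A2 = {} \<and>
           measure (distr J MX fst) A1 > 0 \<and> measure (distr J MX fst) A2 > 0"
    and "\<exists>B1\<in>sets MY. \<exists>B2\<in>sets MY. B1 \<inter> B2 = {} \<and>
           measure (distr J MY snd) B1 > 0 \<and> measure (distr J MY snd) B2 > 0"
    and "0 < r" and "r < 1"
  shows "L2_rate J (rand_scan_gibbs r MX MY KX KY)
           = (1 + sqrt (1 - 4 * r * (1 - r) * (1 - L2_rate J (det_scan_gibbs MX MY KX KY)))) / 2"
proof -
  interpret gibbs_model MX MY J KX KY by (rule gibbs_model.intro[OF assms(1-4)])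
  have r: "0 < r" "r < 1" by fact+
  interpret RG: invariant_kernel_adjoint J "rand_scan_gibbs r MX MY KX KY" "proj.mixture r"
    by (rule rand_scan_adjoint) (use r in auto)
  define \<delta> where "\<delta> = L2_rate J (det_scan_gibbs MX MY KX KY)"
  define l where "l = (1 + sqrt (1 - 4 * r * (1 - r) * (1 - \<delta>))) / 2"
  have \<delta>: "0 \<le> \<delta>" "\<delta> \<le> 1" using det_scan_rate_unit_interval by (auto simp: \<delta>_def)
  note root = quadratic_root_facts[OF r \<delta>, folded l_def]
  have contraction: "sqrt (L2_ip J (proj.mixture r g) (proj.mixture r g)) \<le> l * sqrt (L2_ip J g g)"
    if "g \<in> L2_fun0 J" for g
    using correlation_bound_det_scan_rate root
    by (intro proj.mixture_contraction[where c = \<delta>] that r) (simp_all add: \<delta>_def)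
  have l_rate: "l \<in> RG.L2_rates"
  proof (rule RG.L2_ratesI)
    show "0 < l" "l \<le> 1" using r root by auto
    fix g assume g: "g \<in> L2_fun0 J"
    have "L2_fun_norm J ((proj.mixture r ^^ n) g) \<le> L2_fun_norm J g * l ^ n" for n
    proof (induction n)
      case (Suc n)
      have "L2_fun_norm J ((proj.mixture r ^^ Suc n) g) \<le> l * L2_fun_norm J ((proj.mixture r ^^ n) g)"
        using contraction[OF RG.adjoint_power_in[OF g, of n]] by (simp add: L2_fun_norm_ip)
      also have "\<dots> \<le> l * (L2_fun_norm J g * l ^ n)"
        using Suc \<open>0 < l\<close> by (intro mult_left_mono) auto
      finally show ?case by (simp add: ac_simps)
    qed simp
    then show "\<exists>C. \<forall>n\<ge>1. L2_fun_norm J ((proj.mixture r ^^ n) g) \<le> C * l ^ n" by blast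
  qed
  have lower: "l \<le> k" if k: "k \<in> RG.L2_rates" for k
  proof -
    have k01: "0 \<le> k" "k \<le> 1" using k by (auto simp: RG.L2_rates_def)
    have T: "sqrt (L2_ip J (proj.mixture r g) (proj.mixture r g)) \<le> k * sqrt (L2_ip J g g)"
      if g: "g \<in> L2_fun0 J" for g
    proof -
      obtain C where "\<forall>n\<ge>1. L2_fun_norm J ((proj.mixture r ^^ n) g) \<le> C * k ^ n"
        using RG.L2_ratesD[OF k g] by blast
      then show ?thesis
        by (intro proj.selfadjoint_bound_of_orbit_bound[where U = "L2_fun0 J" and C = C] g k01)
           (auto simp: L2_fun_norm_ip proj.mixture_in proj.mixture_adj)
    qed
    have kr: "r \<le> k"
      using assms(6) nontrivial_avg_x proj.mixture_bound_ge_weight[OF r(2) T] by blast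
    have k1r: "1 - r \<le> k"
    proof -
      \<comment> \<open>exchanging the roles of the two coordinates turns \<open>r\<close> into \<open>1 - r\<close>\<close>
      interpret sw: two_projections "L2_fun0 J" "L2_ip J" avg_y avg_x by (rule proj.swap_projections)
      have "sw.mixture (1 - r) = proj.mixture r"
        by (simp add: sw.mixture_def proj.mixture_def fun_eq_iff)
      then show ?thesis
        using assms(5) nontrivial_avg_y sw.mixture_bound_ge_weight[of "1 - r" k] T r
        by (metis diff_less_eq less_add_same_cancel1)
    qed
    \<comment> \<open>solving the quadratic for the constant at which \<open>k\<close> would be its larger root\<close>
    define c where "c = (k - r) * (k - (1 - r)) / (r * (1 - r))"
    have c: "proj.correlation_bound c"
      unfolding c_def by (rule proj.correlation_bound_of_mixture_bound[OF r T kr k1r])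
    have c0: "0 \<le> c" using r kr k1r by (simp add: c_def)
    have "\<delta> \<le> c"
    proof (rule ccontr)
      assume "\<not> \<delta> \<le> c"
      \<comment> \<open>a strictly larger constant, since \<open>c\<close> may be \<open>0\<close> and only positive constants yield rates\<close>
      then obtain d where d: "c < d" "d < \<delta>" using dense by (metis not_le)
      have "proj.correlation_bound d"
        using c d unfolding proj.correlation_bound_def
        by (meson order_trans mult_right_mono less_imp_le mult_nonneg_nonneg proj.ip_nonneg)
      then have "d \<in> DG.L2_rates" using d c0 \<delta> by (intro det_scan_ratesI) auto
      from det_scan_rate_le[OF this] d show False by (simp add: \<delta>_def)
    qed
    then have "r * (1 - r) * \<delta> \<le> (k - r) * (k - (1 - r))"
      using r by (simp add: c_def le_divide_eq ac_simps)
    then show ?thesis using root kr k1r by blast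
  qed
  have "Inf RG.L2_rates = l" by (rule cInf_eq_minimum[OF l_rate lower])
  then show ?thesis by (simp add: RG.L2_rate_Inf l_def \<delta>_def)
qed

end
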